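(* Let $\mathcal M=(M,<,0,+,\ldots)$ be a definably complete locally o-minimal expansion of an ordered group having definable bounded multiplication. Let $S$ be a definable, closed and bounded subset of $M^n$. Then every definable continuous function $f:S\to M$ has a definable continuous extension $\overline f:M^n\to M$.
   Context: "Definable" means definable in $\mathcal M$ with parameters; $M$ has the order topology and $M^n$ the product topology. An open interval is $(a,b)=\{x\in M: a<x<b\}$, $a<b$ in $M$. Locally o-minimal: for every definable $X\subseteq M$ and $a\in M$ there is an open interval $I\ni a$ such that $X\cap I$ is a finite union of points and open intervals. Definably complete: every definable subset of $M$ has a supremum and an infimum in $M\cup\{\pm\infty\}$. An expansion $\mathcal M=(M,<,0,+,\ldots)$ of a densely linearly ordered group has definable bounded multiplication (compatible to $+$) if there exist an element $1\in M$ and a map $\cdot:M\times M\to M$ such that (1) $(M,<,0,1,+,\cdot)$ is an ordered field, and (2) for every bounded open interval $I$, the restriction $\cdot|_{I\times I}$ is definable in $\mathcal M$. *)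

theory Defs
  imports
    "HOL-Analysis.Function_Topology"
    "HOL-Library.Extended"
    "HOL-Library.Lub_Glb"
    "HOL-Algebra.Ring"
begin

text \<open>
  First-order formulas over the language of ordered groups extended by function symbols from
  \<open>'f\<close> and relation symbols from \<open>'r\<close>. The symbols carry no arity: \<open>f\<close> applied to \<open>k\<close> arguments
  plays the role of a \<open>k\<close>-ary symbol of its own, so every first-order language is covered.
  Variables are de Bruijn indices.
\<close>

datatype 'f trm = Var nat | Zero | Plus "'f trm" "'f trm" | Fn 'f "'f trm list"

datatype ('f, 'r) fm =
    Equal "'f trm" "'f trm"
  | Less "'f trm" "'f trm"
  | Rel 'r "'f trm list"
  | Neg "('f, 'r) fm"
  | Conj "('f, 'r) fm" "('f, 'r) fm"
  | Exi "('f, 'r) fm"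

text \<open>
  An expansion of the ordered group \<open>(M, <, 0, +)\<close>: the underlying ordered group is the type \<open>'a\<close>,
  so only the additional symbols need an interpretation.
\<close>

record ('f, 'r, 'a) expansion =
  fun_interp :: "'f \<Rightarrow> 'a list \<Rightarrow> 'a"
  rel_interp :: "'r \<Rightarrow> 'a list \<Rightarrow> bool"

primrec eval :: "('f, 'r, 'a::linordered_ab_group_add) expansion \<Rightarrow> (nat \<Rightarrow> 'a) \<Rightarrow> 'f trm \<Rightarrow> 'a" where
  "eval \<M> v (Var i) = v i"
| "eval \<M> v Zero = 0"
| "eval \<M> v (Plus s t) = eval \<M> v s + eval \<M> v t"
| "eval \<M> v (Fn f ts) = fun_interp \<M> f (map (eval \<M> v) ts)"

primrec sat :: "('f, 'r, 'a::linordered_ab_group_add) expansion \<Rightarrow> (nat \<Rightarrow> 'a) \<Rightarrow> ('f, 'r) fm \<Rightarrow> bool" where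
  "sat \<M> v (Equal s t) \<longleftrightarrow> eval \<M> v s = eval \<M> v t"
| "sat \<M> v (Less s t) \<longleftrightarrow> eval \<M> v s < eval \<M> v t"
| "sat \<M> v (Rel r ts) \<longleftrightarrow> rel_interp \<M> r (map (eval \<M> v) ts)"
| "sat \<M> v (Neg \<phi>) \<longleftrightarrow> \<not> sat \<M> v \<phi>"
| "sat \<M> v (Conj \<phi> \<psi>) \<longleftrightarrow> sat \<M> v \<phi> \<and> sat \<M> v \<psi>"
| "sat \<M> v (Exi \<phi>) \<longleftrightarrow> (\<exists>a. sat \<M> (case_nat a v) \<phi>)"

text \<open>
  A point of \<open>M\<^sup>n\<close> is a function on \<open>{..<n}\<close>, extended by \<open>undefined\<close> outside. On the type \<open>'a\<close>,
  of class \<open>linorder_topology\<close>, \<open>euclidean\<close> is the order topology.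
\<close>

abbreviation pow_set :: "nat \<Rightarrow> (nat \<Rightarrow> 'a) set" where
  "pow_set n \<equiv> {..<n} \<rightarrow>\<^sub>E UNIV"

abbreviation pow_top :: "nat \<Rightarrow> (nat \<Rightarrow> 'a::topological_space) topology" where
  "pow_top n \<equiv> product_topology (\<lambda>_. euclidean) {..<n}"

text \<open>
  The first \<open>n\<close> variables of \<open>\<phi>\<close> are the coordinates; the remaining free variables are
  instantiated by the parameters \<open>c\<close>.
\<close>

definition definable :: "('f, 'r, 'a::linordered_ab_group_add) expansion \<Rightarrow> nat \<Rightarrow> (nat \<Rightarrow> 'a) set \<Rightarrow> bool" where
  "definable \<M> n S \<longleftrightarrow>
    (\<exists>\<phi> c. S = {x \<in> pow_set n. sat \<M> (\<lambda>i. if i < n then x i else c i) \<phi>})"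

definition definable1 :: "('f, 'r, 'a::linordered_ab_group_add) expansion \<Rightarrow> 'a set \<Rightarrow> bool" where
  "definable1 \<M> X \<longleftrightarrow> definable \<M> 1 {x \<in> pow_set 1. x 0 \<in> X}"

text \<open>A function is definable if its graph, a subset of \<open>M\<^bsup>n+1\<^esup>\<close>, is.\<close>

definition definable_fun ::
  "('f, 'r, 'a::linordered_ab_group_add) expansion \<Rightarrow> nat \<Rightarrow> (nat \<Rightarrow> 'a) set \<Rightarrow> ((nat \<Rightarrow> 'a) \<Rightarrow> 'a) \<Rightarrow> bool" where
  "definable_fun \<M> n S f \<longleftrightarrow> definable \<M> (Suc n) {x(n := f x) |x. x \<in> S}"

definition locally_o_minimal :: "('f, 'r, 'a::linordered_ab_group_add) expansion \<Rightarrow> bool" where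
  "locally_o_minimal \<M> \<longleftrightarrow>
    (\<forall>X a. definable1 \<M> X \<longrightarrow>
      (\<exists>c d \<A>. c < a \<and> a < d \<and> finite \<A> \<and>
        (\<forall>A\<in>\<A>. (\<exists>p. A = {p}) \<or> (\<exists>p q. p < q \<and> A = {p<..<q})) \<and>
        X \<inter> {c<..<d} = \<Union>\<A>))"

definition definably_complete :: "('f, 'r, 'a::linordered_ab_group_add) expansion \<Rightarrow> bool" where
  "definably_complete \<M> \<longleftrightarrow>
    (\<forall>X. definable1 \<M> X \<longrightarrow>
      (\<exists>s::'a extended. isLub UNIV (Fin ` X) s) \<and> (\<exists>t::'a extended. isGlb UNIV (Fin ` X) t))"

text \<open>
  Translation invariance of the order is part of the class of \<open>'a\<close>, so a field structure on top
  of \<open>+\<close> and \<open>0\<close> is an ordered field as soon as products of positive elements are positive.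
\<close>

definition ordered_field_on :: "'a::linordered_ab_group_add \<Rightarrow> ('a \<Rightarrow> 'a \<Rightarrow> 'a) \<Rightarrow> bool" where
  "ordered_field_on u m \<longleftrightarrow>
    field \<lparr>carrier = UNIV, monoid.mult = m, one = u, zero = 0, add = (+)\<rparr> \<and>
    (\<forall>x y. 0 < x \<longrightarrow> 0 < y \<longrightarrow> 0 < m x y)"

definition definable_bounded_multiplication :: "('f, 'r, 'a::linordered_ab_group_add) expansion \<Rightarrow> bool" where
  "definable_bounded_multiplication \<M> \<longleftrightarrow>
    (\<exists>u m. ordered_field_on u m \<and>
      (\<forall>a b. a < b \<longrightarrow>
        definable_fun \<M> 2 ({..<2} \<rightarrow>\<^sub>E {a<..<b}) (\<lambda>x. m (x 0) (x 1))))"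

definition bounded_in_pow :: "nat \<Rightarrow> (nat \<Rightarrow> 'a::linorder) set \<Rightarrow> bool" where
  "bounded_in_pow n S \<longleftrightarrow> (\<exists>a b. S \<subseteq> {..<n} \<rightarrow>\<^sub>E {a<..<b})"

end

theory Submission
  imports Defs
begin

text \<open>
  By definable completeness, a definable continuous \<open>f\<close> on a closed bounded \<open>S\<close> is bounded: otherwise
  the sets \<open>{x \<in> S. t \<le> \<bar>f x\<bar>}\<close> would have a common cluster point, whose coordinates are obtained
  one after the other as infima of definable sets. Adding a constant, we may assume
  \<open>p \<le> f \<le> 2p\<close> with \<open>p > 0\<close>. With \<open>d\<close> the maximum metric and \<open>d(x, S)\<close> the infimum of \<open>d(x, y)\<close>
  over \<open>y \<in> S\<close>, Riesz's formula \<open>G x = (INF y\<in>S. f y \<cdot> d(x, y)) / d(x, S)\<close> for \<open>x \<notin> S\<close>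
  extends \<open>f\<close> continuously. On a box containing \<open>S\<close> all products in this formula have bounded
  factors, so \<open>G\<close> is definable there; composing it with the coordinatewise retraction of \<open>M\<^sup>n\<close>
  onto the box gives the extension.
\<close>

section \<open>Definable predicates on valuations\<close>

primrec rename_trm :: "(nat \<Rightarrow> nat) \<Rightarrow> 'f trm \<Rightarrow> 'f trm" where
  "rename_trm \<sigma> (Var i) = Var (\<sigma> i)"
| "rename_trm \<sigma> Zero = Zero"
| "rename_trm \<sigma> (Plus s t) = Plus (rename_trm \<sigma> s) (rename_trm \<sigma> t)"
| "rename_trm \<sigma> (Fn f ts) = Fn f (map (rename_trm \<sigma>) ts)"

primrec rename_fm :: "(nat \<Rightarrow> nat) \<Rightarrow> ('f, 'r) fm \<Rightarrow> ('f, 'r) fm" where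
  "rename_fm \<sigma> (Equal s t) = Equal (rename_trm \<sigma> s) (rename_trm \<sigma> t)"
| "rename_fm \<sigma> (Less s t) = Less (rename_trm \<sigma> s) (rename_trm \<sigma> t)"
| "rename_fm \<sigma> (Rel r ts) = Rel r (map (rename_trm \<sigma>) ts)"
| "rename_fm \<sigma> (Neg \<phi>) = Neg (rename_fm \<sigma> \<phi>)"
| "rename_fm \<sigma> (Conj \<phi> \<psi>) = Conj (rename_fm \<sigma> \<phi>) (rename_fm \<sigma> \<psi>)"
| "rename_fm \<sigma> (Exi \<phi>) = Exi (rename_fm (case_nat 0 (Suc \<circ> \<sigma>)) \<phi>)"

lemma eval_rename_trm: "eval \<M> v (rename_trm \<sigma> t) = eval \<M> (v \<circ> \<sigma>) t"
  by (induction t) (simp_all add: comp_def cong: map_cong)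

lemma sat_rename_fm: "sat \<M> v (rename_fm \<sigma> \<phi>) \<longleftrightarrow> sat \<M> (v \<circ> \<sigma>) \<phi>"
proof (induction \<phi> arbitrary: v \<sigma>)
  case (Exi \<phi>)
  have "case_nat a v \<circ> case_nat 0 (Suc \<circ> \<sigma>) = case_nat a (v \<circ> \<sigma>)" for a
    by (auto simp: fun_eq_iff split: nat.split)
  then show ?case by (simp only: rename_fm.simps sat.simps Exi)
qed (simp_all add: eval_rename_trm comp_def)

text \<open>
  The map \<open>\<rho>\<close> sends each free variable of the formula either to a coordinate of the valuation or to
  a parameter, so that formulas with different parameters can be combined.
\<close>

definition defpred ::
  "('f, 'r, 'a::linordered_ab_group_add) expansion \<Rightarrow> ((nat \<Rightarrow> 'a) \<Rightarrow> bool) \<Rightarrow> bool" where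
  "defpred \<M> P \<longleftrightarrow> (\<exists>\<phi> \<rho>. \<forall>v. P v \<longleftrightarrow> sat \<M> (case_sum v id \<circ> \<rho>) \<phi>)"

text \<open>The value takes variable 0 and the arguments move up by one, the layout that
  \<open>defpred_ex\<close> expects of a bound variable. The function is total on valuations, so a
  map given only on a subset needs a default value outside it.\<close>

definition deffun ::
  "('f, 'r, 'a::linordered_ab_group_add) expansion \<Rightarrow> ((nat \<Rightarrow> 'a) \<Rightarrow> 'a) \<Rightarrow> bool" where
  "deffun \<M> t \<longleftrightarrow> defpred \<M> (\<lambda>w. w 0 = t (\<lambda>i. w (Suc i)))"

lemma defpredI: "(\<And>v. P v \<longleftrightarrow> sat \<M> (case_sum v id \<circ> \<rho>) \<phi>) \<Longrightarrow> defpred \<M> P"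
  unfolding defpred_def by blast

text \<open>Renaming coordinates or fixing them to constants only changes the assignment:
  \<open>\<tau>\<close> is composed onto the coordinates chosen by \<open>\<rho>\<close>, while
  parameters and the formula stay as they are.\<close>

lemma defpred_instantiate:
  assumes "defpred \<M> P"
  shows "defpred \<M> (\<lambda>v. P (\<lambda>i. case_sum v id (\<tau> i)))"
proof -
  obtain \<phi> \<rho> where P: "\<And>v. P v \<longleftrightarrow> sat \<M> (case_sum v id \<circ> \<rho>) \<phi>"
    using assms unfolding defpred_def by blast
  have "case_sum (\<lambda>i. case_sum v id (\<tau> i)) id \<circ> \<rho> = case_sum v id \<circ> (case_sum \<tau> Inr \<circ> \<rho>)" for v
    by (auto simp: fun_eq_iff split: sum.split)
  then show ?thesis
    by (intro defpredI[where \<rho> = "case_sum \<tau> Inr \<circ> \<rho>" and \<phi> = \<phi>]) (simp add: P)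
qed

lemma defpred_rename: "defpred \<M> P \<Longrightarrow> defpred \<M> (\<lambda>v. P (\<lambda>i. v (\<sigma> i)))"
  using defpred_instantiate[of \<M> P "\<lambda>i. Inl (\<sigma> i)"] by simp

lemma defpred_not: "defpred \<M> P \<Longrightarrow> defpred \<M> (\<lambda>v. \<not> P v)"
  unfolding defpred_def by (metis sat.simps(4))

lemma defpred_conj:
  assumes "defpred \<M> P" "defpred \<M> Q"
  shows "defpred \<M> (\<lambda>v. P v \<and> Q v)"
proof -
  obtain \<phi> \<rho> where P: "\<And>v. P v \<longleftrightarrow> sat \<M> (case_sum v id \<circ> \<rho>) \<phi>"
    using assms unfolding defpred_def by blast
  obtain \<psi> \<tau> where Q: "\<And>v. Q v \<longleftrightarrow> sat \<M> (case_sum v id \<circ> \<tau>) \<psi>"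
    using assms unfolding defpred_def by blast
  \<comment> \<open>Interleaving the two assignments keeps the free variables of both formulas
    apart, so each retains its own parameters.\<close>
  define \<rho>' where "\<rho>' i = (if even i then \<rho> (i div 2) else \<tau> (i div 2))" for i
  have "\<rho>' \<circ> (\<lambda>i. 2 * i) = \<rho>" "\<rho>' \<circ> (\<lambda>i. 2 * i + 1) = \<tau>"
    by (simp_all add: \<rho>'_def fun_eq_iff)
  then have "P v \<and> Q v \<longleftrightarrow> sat \<M> (case_sum v id \<circ> \<rho>')
      (Conj (rename_fm (\<lambda>i. 2 * i) \<phi>) (rename_fm (\<lambda>i. 2 * i + 1) \<psi>))" for v
    by (simp add: P Q sat_rename_fm comp_assoc)
  then show ?thesis by (rule defpredI)
qed

lemma defpred_disj:
  assumes "defpred \<M> P" "defpred \<M> Q"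
  shows "defpred \<M> (\<lambda>v. P v \<or> Q v)"
proof -
  have "defpred \<M> (\<lambda>v. \<not> (\<not> P v \<and> \<not> Q v))"
    using assms by (intro defpred_not defpred_conj)
  then show ?thesis by simp
qed

lemma defpred_imp:
  assumes "defpred \<M> P" "defpred \<M> Q"
  shows "defpred \<M> (\<lambda>v. P v \<longrightarrow> Q v)"
proof -
  have "defpred \<M> (\<lambda>v. \<not> P v \<or> Q v)"
    using assms by (intro defpred_not defpred_disj)
  then show ?thesis by simp
qed

lemma defpred_ex:
  assumes "defpred \<M> (\<lambda>w. Q (w 0) (\<lambda>i. w (Suc i)))"
  shows "defpred \<M> (\<lambda>v. \<exists>a. Q a v)"
proof -
  obtain \<phi> \<rho> where Q: "\<And>w. Q (w 0) (\<lambda>i. w (Suc i)) \<longleftrightarrow> sat \<M> (case_sum w id \<circ> \<rho>) \<phi>"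
    using assms unfolding defpred_def by blast
  \<comment> \<open>Several free variables of \<open>\<phi>\<close> may stand for coordinate 0; all
    of them are merged into the new bound variable. The others are shifted past the binder, and
    their coordinates drop by one because the valuation loses its head.\<close>
  define \<sigma> where "\<sigma> i = (if \<rho> i = Inl 0 then 0 else Suc i)" for i
  define \<rho>' where "\<rho>' i = (case \<rho> i of Inl j \<Rightarrow> Inl (j - 1) | Inr c \<Rightarrow> Inr c)" for i
  have "case_nat a (case_sum v id \<circ> \<rho>') \<circ> \<sigma> = case_sum (case_nat a v) id \<circ> \<rho>" for a v
    by (auto simp: fun_eq_iff \<sigma>_def \<rho>'_def split: sum.split nat.split)
  then have "(\<exists>a. Q a v) \<longleftrightarrow> sat \<M> (case_sum v id \<circ> \<rho>') (Exi (rename_fm \<sigma> \<phi>))" for v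
    using Q[of "case_nat _ v"] by (simp add: sat_rename_fm)
  then show ?thesis by (rule defpredI)
qed

lemma defpred_all:
  assumes "defpred \<M> (\<lambda>w. Q (w 0) (\<lambda>i. w (Suc i)))"
  shows "defpred \<M> (\<lambda>v. \<forall>a. Q a v)"
proof -
  have "defpred \<M> (\<lambda>v. \<not> (\<exists>a. \<not> Q a v))"
    using assms by (intro defpred_not defpred_ex)
  then show ?thesis by simp
qed

lemma restrict_lessThan_Suc:
  "restrict w {..<Suc n} = (restrict w {..<n})(n := w n)"
  by (auto simp: fun_eq_iff restrict_def)

lemma ex_pow_set_Suc: "(\<exists>y\<in>pow_set (Suc n). Q y) \<longleftrightarrow> (\<exists>a. \<exists>y\<in>pow_set n. Q (y(n := a)))"
proof safe
  fix y assume "y \<in> pow_set (Suc n)" "Q y"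
  then have "restrict y {..<n} \<in> pow_set n" "(restrict y {..<n})(n := y n) = y"
    by (auto simp: fun_eq_iff restrict_def PiE_iff extensional_def)
  then show "\<exists>a. \<exists>y\<in>pow_set n. Q (y(n := a))" using \<open>Q y\<close> by metis
next
  fix a and y :: "nat \<Rightarrow> 'a" assume "y \<in> pow_set n" "Q (y(n := a))"
  moreover from this have "y(n := a) \<in> pow_set (Suc n)"
    by (auto simp: PiE_iff extensional_def)
  ultimately show "\<exists>y\<in>pow_set (Suc n). Q y" by blast
qed

text \<open>One quantifier per coordinate. The last coordinate is quantified outermost, so it ends
  up at variable \<open>n\<close>, directly behind the inner \<open>n\<close>-tuple, as the next
  restriction requires.\<close>

lemma defpred_ex_tuple:
  assumes "defpred \<M> (\<lambda>w. Q (\<lambda>i\<in>{..<n}. w i) (\<lambda>i. w (n + i)))"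
  shows "defpred \<M> (\<lambda>v. \<exists>y\<in>pow_set n. Q y v)"
  using assms
proof (induction n arbitrary: Q)
  case 0
  then show ?case by (simp add: restrict_def)
next
  case (Suc n)
  have "defpred \<M> (\<lambda>v. \<exists>a. \<exists>y\<in>pow_set n. Q (y(n := a)) v)"
    using Suc.prems
    by (intro defpred_ex Suc.IH)
      (simp only: restrict_lessThan_Suc add_0_right add_Suc add_Suc_right)
  then show ?case by (simp add: ex_pow_set_Suc)
qed

lemma defpred_all_tuple:
  assumes "defpred \<M> (\<lambda>w. Q (\<lambda>i\<in>{..<n}. w i) (\<lambda>i. w (n + i)))"
  shows "defpred \<M> (\<lambda>v. \<forall>y\<in>pow_set n. Q y v)"
proof -
  have "defpred \<M> (\<lambda>v. \<not> (\<exists>y\<in>pow_set n. \<not> Q y v))"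
    using assms by (intro defpred_not defpred_ex_tuple)
  then show ?thesis by simp
qed

section \<open>Atomic predicates and closure of definable functions\<close>

lemma defpred_var_eq: "defpred \<M> (\<lambda>v. v i = v j)"
  by (rule defpredI[where \<rho> = Inl and \<phi> = "Equal (Var i) (Var j)"]) simp

lemma defpred_var_less: "defpred \<M> (\<lambda>v. v i < v j)"
  by (rule defpredI[where \<rho> = Inl and \<phi> = "Less (Var i) (Var j)"]) simp

lemma defpred_var_plus: "defpred \<M> (\<lambda>v. v i = v j + v k)"
  by (rule defpredI[where \<rho> = Inl and \<phi> = "Equal (Var i) (Plus (Var j) (Var k))"]) simp

lemma defpred_True: "defpred \<M> (\<lambda>v. True)"
  using defpred_var_eq[of \<M> 0 0] by simp

lemma defpred_False: "defpred \<M> (\<lambda>v. False)"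
  using defpred_not[OF defpred_True] by simp

lemma defpred_const: "defpred \<M> (\<lambda>v. b)"
  by (cases b) (simp_all add: defpred_True defpred_False)

lemma defpred_all_less:
  fixes n :: nat
  assumes "\<And>i. i < n \<Longrightarrow> defpred \<M> (P i)"
  shows "defpred \<M> (\<lambda>v. \<forall>i<n. P i v)"
  using assms
  by (induction n) (simp_all add: defpred_True defpred_conj All_less_Suc)

lemma deffun_rename: "deffun \<M> t \<Longrightarrow> deffun \<M> (\<lambda>v. t (\<lambda>i. v (\<sigma> i)))"
  unfolding deffun_def
  by (drule defpred_rename[where \<sigma> = "case_nat 0 (Suc \<circ> \<sigma>)"]) simp

lemma deffun_var: "deffun \<M> (\<lambda>v. v i)"
  unfolding deffun_def by (rule defpred_var_eq)

lemma deffun_const: "deffun \<M> (\<lambda>v. c)"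
  unfolding deffun_def
  using defpred_instantiate[OF defpred_var_eq[of \<M> 0 1], of "case_nat (Inl 0) (\<lambda>_. Inr c)"]
  by simp

text \<open>Substitution amounts to quantifying over the values of the three terms. Three slots
  cover binary relations, with one slot ignored, and graphs of binary operations. The outermost
  value gets index 2, hence the order-reversing renaming in the last case.\<close>

lemma defpred_subst:
  assumes "defpred \<M> (\<lambda>w. R (w 0) (w 1) (w 2))" "deffun \<M> r" "deffun \<M> s" "deffun \<M> t"
  shows "defpred \<M> (\<lambda>v. R (r v) (s v) (t v))"
proof -
  have "defpred \<M> (\<lambda>v. \<exists>a b c. (a = r v \<and> b = s v \<and> c = t v) \<and> R a b c)"
  proof (intro defpred_ex defpred_conj)
    show "defpred \<M> (\<lambda>w. w (Suc (Suc 0)) = r (\<lambda>i. w (Suc (Suc (Suc i)))))"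
      using defpred_rename[OF assms(2)[unfolded deffun_def],
        of "case_nat 2 (\<lambda>i. Suc (Suc (Suc i)))"] by (simp add: numeral_2_eq_2)
    show "defpred \<M> (\<lambda>w. w (Suc 0) = s (\<lambda>i. w (Suc (Suc (Suc i)))))"
      using defpred_rename[OF assms(3)[unfolded deffun_def],
        of "case_nat 1 (\<lambda>i. Suc (Suc (Suc i)))"] by simp
    show "defpred \<M> (\<lambda>w. w 0 = t (\<lambda>i. w (Suc (Suc (Suc i)))))"
      using defpred_rename[OF assms(4)[unfolded deffun_def],
        of "case_nat 0 (\<lambda>i. Suc (Suc (Suc i)))"] by simp
    show "defpred \<M> (\<lambda>w. R (w (Suc (Suc 0))) (w (Suc 0)) (w 0))"
      using defpred_rename[OF assms(1), of "\<lambda>i. 2 - i"] by (simp add: numeral_2_eq_2)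
  qed
  then show ?thesis by simp
qed

lemma defpred_eq: "deffun \<M> s \<Longrightarrow> deffun \<M> t \<Longrightarrow> defpred \<M> (\<lambda>v. s v = t v)"
  using defpred_subst[of \<M> "\<lambda>a b c. a = b" s t t] defpred_var_eq by blast

lemma defpred_less: "deffun \<M> s \<Longrightarrow> deffun \<M> t \<Longrightarrow> defpred \<M> (\<lambda>v. s v < t v)"
  using defpred_subst[of \<M> "\<lambda>a b c. a < b" s t t] defpred_var_less by blast

lemma defpred_le: "deffun \<M> s \<Longrightarrow> deffun \<M> t \<Longrightarrow> defpred \<M> (\<lambda>v. s v \<le> t v)"
  using defpred_not[OF defpred_less[of \<M> t s]] by (simp add: not_less)

lemma deffun_subst2:
  assumes "defpred \<M> (\<lambda>w. w 0 = F (w 1) (w 2))" "deffun \<M> s" "deffun \<M> t"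
  shows "deffun \<M> (\<lambda>v. F (s v) (t v))"
  unfolding deffun_def
  by (rule defpred_subst[of \<M> "\<lambda>a b c. a = F b c", OF assms(1) deffun_var])
    (rule deffun_rename, fact assms)+

lemma deffun_plus: "deffun \<M> s \<Longrightarrow> deffun \<M> t \<Longrightarrow> deffun \<M> (\<lambda>v. s v + t v)"
  by (rule deffun_subst2[of \<M> "(+)"]) (rule defpred_var_plus)

lemma deffun_if:
  assumes "defpred \<M> P" "deffun \<M> s" "deffun \<M> t"
  shows "deffun \<M> (\<lambda>v. if P v then s v else t v)"
proof -
  have "defpred \<M> (\<lambda>w. (P (\<lambda>i. w (Suc i)) \<longrightarrow> w 0 = s (\<lambda>i. w (Suc i))) \<and>
      (\<not> P (\<lambda>i. w (Suc i)) \<longrightarrow> w 0 = t (\<lambda>i. w (Suc i))))"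
    using assms(2,3) defpred_rename[OF assms(1), of Suc] unfolding deffun_def
    by (intro defpred_imp defpred_conj defpred_not)
  then show ?thesis by (simp add: deffun_def)
qed

lemma deffun_minus:
  assumes "deffun \<M> s" "deffun \<M> t" shows "deffun \<M> (\<lambda>v. s v - t v)"
proof (rule deffun_subst2[of \<M> "(-)"])
  have "defpred \<M> (\<lambda>w. w 1 = w 0 + w 2)" by (rule defpred_var_plus)
  then show "defpred \<M> (\<lambda>w. w 0 = w 1 - w 2)" by (simp add: eq_diff_eq eq_commute)
qed fact+

lemma deffun_max: "deffun \<M> s \<Longrightarrow> deffun \<M> t \<Longrightarrow> deffun \<M> (\<lambda>v. max (s v) (t v))"
  unfolding max_def by (intro deffun_if defpred_le)

lemma deffun_min: "deffun \<M> s \<Longrightarrow> deffun \<M> t \<Longrightarrow> deffun \<M> (\<lambda>v. min (s v) (t v))"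
  unfolding min_def by (intro deffun_if defpred_le)

section \<open>Definable sets and maps as definable predicates\<close>

lemma definable_subset_pow_set: "definable \<M> n S \<Longrightarrow> S \<subseteq> pow_set n"
  unfolding definable_def by blast

lemma definable_iff_defpred:
  assumes S: "S \<subseteq> pow_set n"
  shows "definable \<M> n S \<longleftrightarrow> defpred \<M> (\<lambda>v. (\<lambda>i\<in>{..<n}. v i) \<in> S)"
proof
  assume "definable \<M> n S"
  then obtain \<phi> c where S_eq: "S = {x \<in> pow_set n. sat \<M> (\<lambda>i. if i < n then x i else c i) \<phi>}"
    unfolding definable_def by blast
  have "(\<lambda>i. if i < n then (\<lambda>i\<in>{..<n}. v i) i else c i) =
      case_sum v id \<circ> (\<lambda>i. if i < n then Inl i else Inr (c i))" for v
    by (auto simp: fun_eq_iff)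
  then show "defpred \<M> (\<lambda>v. (\<lambda>i\<in>{..<n}. v i) \<in> S)"
    unfolding S_eq by (intro defpredI) (simp only: mem_Collect_eq, simp)
next
  assume "defpred \<M> (\<lambda>v. (\<lambda>i\<in>{..<n}. v i) \<in> S)"
  then obtain \<phi> \<rho> where
    \<phi>: "\<And>v. (\<lambda>i\<in>{..<n}. v i) \<in> S \<longleftrightarrow> sat \<M> (case_sum v id \<circ> \<rho>) \<phi>"
    unfolding defpred_def by blast
  \<comment> \<open>Every free variable that is not one of the first \<open>n\<close> coordinates
    gets its own parameter slot \<open>n + i\<close>. For a coordinate \<open>j\<close> beyond these
    the parameter is \<open>undefined\<close>, which is the value there of a point of
    \<open>pow_set n\<close>.\<close>
  define \<sigma> where "\<sigma> i = (case \<rho> i of Inl j \<Rightarrow> if j < n then j else n + i | Inr c \<Rightarrow> n + i)" for i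
  define c where "c i = (case \<rho> (i - n) of Inl j \<Rightarrow> undefined | Inr c \<Rightarrow> c)" for i
  have "x \<in> S \<longleftrightarrow> sat \<M> (\<lambda>i. if i < n then x i else c i) (rename_fm \<sigma> \<phi>)"
    if x: "x \<in> pow_set n" for x
  proof -
    have "(\<lambda>i. if i < n then x i else c i) \<circ> \<sigma> = case_sum x id \<circ> \<rho>"
      using x by (auto simp: fun_eq_iff \<sigma>_def c_def PiE_iff extensional_def split: sum.split)
    moreover have "(\<lambda>i\<in>{..<n}. x i) = x" using x by (rule PiE_restrict)
    ultimately show ?thesis using \<phi>[of x] by (simp add: sat_rename_fm)
  qed
  then have "S = {x \<in> pow_set n. sat \<M> (\<lambda>i. if i < n then x i else c i) (rename_fm \<sigma> \<phi>)}"
    using S by blast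
  then show "definable \<M> n S" unfolding definable_def by blast
qed

lemma defpred_mem:
  assumes "definable \<M> n S"
  shows "defpred \<M> (\<lambda>v. (\<lambda>i\<in>{..<n}. v (\<sigma> i)) \<in> S)"
  using defpred_rename[of \<M> "\<lambda>v. (\<lambda>i\<in>{..<n}. v i) \<in> S" \<sigma>]
    definable_iff_defpred[OF definable_subset_pow_set[OF assms], of \<M>] assms
  by (simp only:)

lemma definable1_iff_defpred: "definable1 \<M> X \<longleftrightarrow> defpred \<M> (\<lambda>v. v 0 \<in> X)"
  unfolding definable1_def by (subst definable_iff_defpred) auto

lemma definable_fun_iff_defpred:
  assumes S: "S \<subseteq> pow_set n"
  shows "definable_fun \<M> n S f \<longleftrightarrow>
    defpred \<M> (\<lambda>v. (\<lambda>i\<in>{..<n}. v i) \<in> S \<and> v n = f (\<lambda>i\<in>{..<n}. v i))"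
proof -
  have "{x(n := f x) |x. x \<in> S} \<subseteq> pow_set (Suc n)"
  proof
    fix y assume "y \<in> {x(n := f x) |x. x \<in> S}"
    then obtain x where "y = x(n := f x)" "x \<in> pow_set n" using S by blast
    then show "y \<in> pow_set (Suc n)" by (auto simp: PiE_iff extensional_def)
  qed
  moreover have "(\<lambda>i\<in>{..<Suc n}. v i) \<in> {x(n := f x) |x. x \<in> S} \<longleftrightarrow>
      (\<lambda>i\<in>{..<n}. v i) \<in> S \<and> v n = f (\<lambda>i\<in>{..<n}. v i)" for v :: "nat \<Rightarrow> 'a"
  proof
    assume "(\<lambda>i\<in>{..<Suc n}. v i) \<in> {x(n := f x) |x. x \<in> S}"
    then obtain x where x: "x \<in> S" "(\<lambda>i\<in>{..<Suc n}. v i) = x(n := f x)" by blast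
    have "v i = x i" if "i < n" for i
      using fun_cong[OF x(2), of i] that by simp
    then have "(\<lambda>i\<in>{..<n}. v i) = x"
      using x(1) S by (auto simp: fun_eq_iff restrict_def PiE_iff extensional_def)
    moreover have "v n = f x" using fun_cong[OF x(2), of n] by simp
    ultimately show "(\<lambda>i\<in>{..<n}. v i) \<in> S \<and> v n = f (\<lambda>i\<in>{..<n}. v i)" using x(1) by simp
  next
    assume "(\<lambda>i\<in>{..<n}. v i) \<in> S \<and> v n = f (\<lambda>i\<in>{..<n}. v i)"
    then show "(\<lambda>i\<in>{..<Suc n}. v i) \<in> {x(n := f x) |x. x \<in> S}"
      unfolding restrict_lessThan_Suc by (metis (mono_tags, lifting) mem_Collect_eq)
  qed
  ultimately show ?thesis
    unfolding definable_fun_def by (simp only: definable_iff_defpred)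
qed

text \<open>Membership in \<open>S\<close> is definable, so the partial function \<open>f\<close>
  becomes a total definable one by a case distinction with default value 0.\<close>

lemma deffun_extend_zero:
  assumes f: "definable_fun \<M> n S f" and S: "definable \<M> n S"
  shows "deffun (\<M> :: ('f, 'r, 'a::linordered_ab_group_add) expansion)
    (\<lambda>v. if (\<lambda>i\<in>{..<n}. v (\<sigma> i)) \<in> S then f (\<lambda>i\<in>{..<n}. v (\<sigma> i)) else 0)"
proof -
  have "defpred \<M> (\<lambda>v. (\<lambda>i\<in>{..<n}. v i) \<in> S \<and> v n = f (\<lambda>i\<in>{..<n}. v i))"
    by (rule iffD1[OF definable_fun_iff_defpred[OF definable_subset_pow_set[OF S]] f])
  \<comment> \<open>The graph stores the value at coordinate \<open>n\<close>, whereas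
    \<open>deffun\<close> wants it at variable 0, with the arguments shifted up.\<close>
  from defpred_rename[OF this, of "\<lambda>i. if i < n then Suc (\<sigma> i) else 0"]
  have "defpred \<M> (\<lambda>v. (\<lambda>i\<in>{..<n}. v (Suc (\<sigma> i))) \<in> S \<and> v 0 = f (\<lambda>i\<in>{..<n}. v (Suc (\<sigma> i))))"
    by (simp cong: restrict_cong)
  then have "defpred \<M> (\<lambda>v.
      ((\<lambda>i\<in>{..<n}. v (Suc (\<sigma> i))) \<in> S \<longrightarrow>
        (\<lambda>i\<in>{..<n}. v (Suc (\<sigma> i))) \<in> S \<and> v 0 = f (\<lambda>i\<in>{..<n}. v (Suc (\<sigma> i)))) \<and>
      ((\<lambda>i\<in>{..<n}. v (Suc (\<sigma> i))) \<notin> S \<longrightarrow> v 0 = 0))"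
    using defpred_eq[OF deffun_var[of \<M> 0] deffun_const[of \<M> 0]]
      defpred_mem[OF S, of "\<lambda>i. Suc (\<sigma> i)"]
    by - (assumption | rule defpred_conj defpred_imp defpred_not)+
  moreover have "z = (if b then p else q) \<longleftrightarrow> (b \<longrightarrow> b \<and> z = p) \<and> (\<not> b \<longrightarrow> z = q)" for b and z p q :: 'a
    by auto
  ultimately show ?thesis
    unfolding deffun_def by (simp only:)
qed

section \<open>Definability of distances and infima\<close>

primrec box_dist :: "nat \<Rightarrow> (nat \<Rightarrow> 'a) \<Rightarrow> (nat \<Rightarrow> 'a) \<Rightarrow> 'a::linordered_ab_group_add" where
  "box_dist 0 x y = 0"
| "box_dist (Suc n) x y = max (box_dist n x y) (max (x n - y n) (y n - x n))"

lemma deffun_box_dist: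
  assumes "\<And>i. i < n \<Longrightarrow> deffun \<M> (\<lambda>v. x v i)" "\<And>i. i < n \<Longrightarrow> deffun \<M> (\<lambda>v. y v i)"
  shows "deffun \<M> (\<lambda>v. box_dist n (x v) (y v))"
  using assms by (induction n) (simp_all add: deffun_const deffun_max deffun_minus)

lemma isGlb_UNIV_iff:
  "isGlb UNIV A z \<longleftrightarrow> (\<forall>a\<in>A. z \<le> a) \<and> (\<forall>z'. (\<forall>a\<in>A. z' \<le> a) \<longrightarrow> z' \<le> z)"
  by (auto simp: isGlb_def greatestP_def isLb_def setge_def setle_def)

text \<open>Being an infimum is a first-order property. Stated as a relation with \<open>z\<close>,
  it can be used inside formulas before the existence of the infimum is known.\<close>

lemma defpred_isGlb:
  assumes S: "definable \<M> n S"
    and T: "deffun \<M> (\<lambda>w. T (\<lambda>i\<in>{..<n}. w i) (\<lambda>i. w (n + i)))"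
    and z: "deffun \<M> z"
  shows "defpred \<M> (\<lambda>v. isGlb UNIV ((\<lambda>y. T y v) ` S) (z v))"
proof -
  have "defpred \<M> (\<lambda>v. (\<forall>y\<in>pow_set n. y \<in> S \<longrightarrow> z v \<le> T y v) \<and>
      (\<forall>z'. (\<forall>y\<in>pow_set n. y \<in> S \<longrightarrow> z' \<le> T y v) \<longrightarrow> z' \<le> z v))"
  proof (intro defpred_conj defpred_all defpred_all_tuple defpred_imp defpred_le deffun_var)
    \<comment> \<open>Variable \<open>n\<close> now holds the competing lower bound
      \<open>z'\<close>, so the remaining variables are renamed to skip it.\<close>
    show "deffun \<M> (\<lambda>w. T (\<lambda>i\<in>{..<n}. w i) (\<lambda>i. w (n + Suc i)))"
      using deffun_rename[OF T, of "\<lambda>i. if i < n then i else Suc i"] by (simp cong: restrict_cong)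
  qed (use T deffun_rename[OF z] defpred_mem[OF S] in auto)
  moreover have "(\<forall>y\<in>pow_set n. y \<in> S \<longrightarrow> Q y) \<longleftrightarrow> (\<forall>y\<in>S. Q y)" for Q
    using definable_subset_pow_set[OF S] by blast
  ultimately show ?thesis by (simp add: isGlb_UNIV_iff)
qed

text \<open>Definable completeness provides an infimum that may be infinite: the lower bound
  \<open>l\<close> excludes minus infinity, and an element of \<open>X\<close> excludes plus
  infinity.\<close>

lemma definably_complete_isGlb:
  fixes \<M> :: "('f, 'r, 'a::linordered_ab_group_add) expansion"
  assumes "definably_complete \<M>" "definable1 \<M> X" "X \<noteq> {}" "\<And>x. x \<in> X \<Longrightarrow> l \<le> x"
  obtains z where "isGlb UNIV X z"
proof -
  obtain t :: "'a extended" where t: "isGlb UNIV (Fin ` X) t"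
    using assms(1,2) unfolding definably_complete_def by blast
  have "Fin l \<le> t" using t assms(4) by (auto simp: isGlb_UNIV_iff)
  moreover obtain x where "x \<in> X" using assms(3) by blast
  then have "t \<le> Fin x" using t by (auto simp: isGlb_UNIV_iff)
  ultimately obtain z where "t = Fin z" by (cases t) auto
  then have "z' \<le> z" if "\<forall>x\<in>X. z' \<le> x" for z'
    using t that unfolding isGlb_UNIV_iff by (metis (no_types, lifting) image_iff less_eq_extended.simps(1))
  with \<open>t = Fin z\<close> have "isGlb UNIV X z" using t by (auto simp: isGlb_UNIV_iff)
  then show thesis by (rule that)
qed

lemma definably_complete_isGlb_image:
  fixes \<M> :: "('f, 'r, 'a::linordered_ab_group_add) expansion"
  assumes "definably_complete \<M>" "definable \<M> n S" "S \<noteq> {}" "\<And>y. y \<in> S \<Longrightarrow> l \<le> T y"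
    and T: "deffun \<M> (\<lambda>w. T (\<lambda>i\<in>{..<n}. w i))"
  obtains z where "isGlb UNIV (T ` S) z"
proof (rule definably_complete_isGlb[OF assms(1), of "T ` S" l])
  have "defpred \<M> (\<lambda>v. \<exists>y\<in>pow_set n. y \<in> S \<and> v 0 = T y)"
    by (intro defpred_ex_tuple defpred_conj defpred_eq deffun_var T defpred_mem[OF assms(2)])
  moreover have "(\<exists>y\<in>pow_set n. y \<in> S \<and> a = T y) \<longleftrightarrow> a \<in> T ` S" for a
    using definable_subset_pow_set[OF assms(2)] by blast
  ultimately show "definable1 \<M> (T ` S)"
    by (simp only: definable1_iff_defpred)
qed (use assms that in auto)

section \<open>The maximum metric\<close>

text \<open>Density replaces division by two: a point \<open>c\<close> strictly between 0 and
  \<open>e\<close> splits \<open>e\<close> into two positive pieces, and the smaller piece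
  serves.\<close>

lemma ordered_group_half:
  fixes e :: "'a::{linordered_ab_group_add, dense_linorder}"
  assumes "0 < e"
  obtains d where "0 < d" "d + d \<le> e"
proof -
  obtain c where c: "0 < c" "c < e" using assms dense by blast
  show thesis
  proof (rule that)
    show "0 < min c (e - c)" using c by simp
    have "min c (e - c) + min c (e - c) \<le> c + (e - c)" by (intro add_mono) auto
    then show "min c (e - c) + min c (e - c) \<le> e" by simp
  qed
qed

lemma box_dist_le_iff: "box_dist n x y \<le> e \<longleftrightarrow> 0 \<le> e \<and> (\<forall>i<n. x i - y i \<le> e \<and> y i - x i \<le> e)"
  by (induction n) (auto simp: All_less_Suc)

lemma box_dist_less_iff: "box_dist n x y < e \<longleftrightarrow> 0 < e \<and> (\<forall>i<n. x i - y i < e \<and> y i - x i < e)"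
  by (induction n) (auto simp: All_less_Suc)

lemma box_dist_nonneg: "0 \<le> box_dist n x y"
  using box_dist_le_iff[of n x y "box_dist n x y"] by simp

lemma box_dist_commute: "box_dist n x y = box_dist n y x"
  by (induction n) (simp_all add: max.commute)

lemma box_dist_triangle: "box_dist n x z \<le> box_dist n x y + box_dist n y z"
proof -
  have "x i - y i \<le> box_dist n x y \<and> y i - x i \<le> box_dist n x y"
    "y i - z i \<le> box_dist n y z \<and> z i - y i \<le> box_dist n y z" if "i < n" for i
    using box_dist_le_iff[of n _ _ "box_dist n _ _"] that by blast+
  then have "(x i - y i) + (y i - z i) \<le> box_dist n x y + box_dist n y z \<and>
      (y i - x i) + (z i - y i) \<le> box_dist n x y + box_dist n y z" if "i < n" for i
    using that by (intro conjI add_mono) blast+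
  then show ?thesis by (simp add: box_dist_le_iff box_dist_nonneg)
qed

text \<open>The positive element \<open>e\<^sub>0\<close> provides points on both sides of
  \<open>a\<close>, from which one-sided neighbourhoods inside \<open>A\<close> are obtained. The
  smaller of their two lengths is a symmetric radius.\<close>

lemma open_contains_interval:
  fixes A :: "'a::{linordered_ab_group_add, linorder_topology} set"
  assumes "open A" "a \<in> A" "(0::'a) < e\<^sub>0"
  obtains e where "0 < e" "\<And>z. a - z < e \<Longrightarrow> z - a < e \<Longrightarrow> z \<in> A"
proof -
  obtain b where b: "a < b" "{a..<b} \<subseteq> A"
    using open_right[OF assms(1,2), of "a + e\<^sub>0"] assms(3) by auto
  obtain c where c: "c < a" "{c<..a} \<subseteq> A"
    using open_left[OF assms(1,2), of "a - e\<^sub>0"] assms(3) by auto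
  show thesis
  proof (rule that)
    show "0 < min (b - a) (a - c)" using b(1) c(1) by simp
    fix z assume "a - z < min (b - a) (a - c)" "z - a < min (b - a) (a - c)"
    then have "c < z" "z < b" by auto
    then show "z \<in> A" using b(2) c(2) by (cases "a \<le> z") auto
  qed
qed

text \<open>With finitely many coordinates, the product topology is that of the maximum distance:
  coordinatewise radii have a positive minimum, and a ball is an open box.\<close>

lemma openin_pow_top_iff:
  fixes U :: "(nat \<Rightarrow> 'a::{linordered_ab_group_add, linorder_topology}) set"
  assumes e\<^sub>0: "(0::'a) < e\<^sub>0"
  shows "openin (pow_top n) U \<longleftrightarrow> U \<subseteq> pow_set n \<and>
    (\<forall>x\<in>U. \<exists>e>0. \<forall>y\<in>pow_set n. box_dist n x y < e \<longrightarrow> y \<in> U)"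
proof (intro iffI conjI ballI)
  assume U: "openin (pow_top n) U"
  then show "U \<subseteq> pow_set n" using openin_subset by fastforce
  fix x assume "x \<in> U"
  from product_topology_open_contains_basis[OF U this]
  obtain X where X: "x \<in> (\<Pi>\<^sub>E i\<in>{..<n}. X i)" "\<And>i. open (X i)" "(\<Pi>\<^sub>E i\<in>{..<n}. X i) \<subseteq> U"
    by (elim exE conjE) simp
  have "\<exists>e>0. \<forall>z. x i - z < e \<longrightarrow> z - x i < e \<longrightarrow> z \<in> X i" if "i < n" for i
    using open_contains_interval[OF X(2) _ e\<^sub>0, of "x i" i] X(1) that by (auto simp: PiE_iff) metis
  then obtain r where r: "\<And>i. i < n \<Longrightarrow> 0 < r i"
    "\<And>i z. i < n \<Longrightarrow> x i - z < r i \<Longrightarrow> z - x i < r i \<Longrightarrow> z \<in> X i" by metis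
  \<comment> \<open>Inserting \<open>e\<^sub>0\<close> keeps the set nonempty when
    \<open>n = 0\<close>.\<close>
  define e where "e = Min (insert e\<^sub>0 (r ` {..<n}))"
  have "0 < e" using r(1) e\<^sub>0 by (auto simp: e_def)
  moreover have "e \<le> r i" if "i < n" for i using that by (auto simp: e_def)
  then have "y \<in> U" if "y \<in> pow_set n" "box_dist n x y < e" for y
  proof -
    have "y \<in> (\<Pi>\<^sub>E i\<in>{..<n}. X i)"
      using that r(2) \<open>\<And>i. i < n \<Longrightarrow> e \<le> r i\<close>
      by (auto simp: PiE_iff box_dist_less_iff) (meson less_le_trans)
    then show ?thesis using X(3) by blast
  qed
  ultimately show "\<exists>e>0. \<forall>y\<in>pow_set n. box_dist n x y < e \<longrightarrow> y \<in> U" by blast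
next
  assume U: "U \<subseteq> pow_set n \<and> (\<forall>x\<in>U. \<exists>e>0. \<forall>y\<in>pow_set n. box_dist n x y < e \<longrightarrow> y \<in> U)"
  show "openin (pow_top n) U"
  proof (subst openin_subopen, intro ballI)
    fix x assume "x \<in> U"
    then have "\<exists>e>0. \<forall>y\<in>pow_set n. box_dist n x y < e \<longrightarrow> y \<in> U" using U by blast
    then obtain e where e: "0 < e" "\<And>y. y \<in> pow_set n \<Longrightarrow> box_dist n x y < e \<Longrightarrow> y \<in> U"
      by auto
    define T where "T = (\<Pi>\<^sub>E i\<in>{..<n}. {x i - e<..<x i + e})"
    have "openin (pow_top n) T" unfolding T_def by (simp add: openin_PiE)
    moreover have "x \<in> T"
      using \<open>x \<in> U\<close> U e(1) unfolding T_def by (auto simp: PiE_iff less_diff_eq diff_less_eq)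
    moreover have "T \<subseteq> U"
      using e by (auto simp: T_def PiE_iff box_dist_less_iff algebra_simps)
    ultimately show "\<exists>T. openin (pow_top n) T \<and> x \<in> T \<and> T \<subseteq> U" by blast
  qed
qed

lemma closedin_pow_top_separated:
  fixes S :: "(nat \<Rightarrow> 'a::{linordered_ab_group_add, linorder_topology}) set"
  assumes "(0::'a) < e\<^sub>0" "closedin (pow_top n) S" "x \<in> pow_set n" "x \<notin> S"
  obtains e where "0 < e" "\<And>y. y \<in> S \<Longrightarrow> e \<le> box_dist n x y"
proof -
  have S: "S \<subseteq> pow_set n" using closedin_subset[OF assms(2)] by simp
  have "openin (pow_top n) (pow_set n - S)"
    using assms(2) by (simp add: closedin_def)
  then obtain e where "0 < e" "\<forall>y\<in>pow_set n. box_dist n x y < e \<longrightarrow> y \<in> pow_set n - S"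
    using assms(3,4) unfolding openin_pow_top_iff[OF assms(1)] by blast
  then show thesis using S by (intro that[of e]) (auto simp: not_less[symmetric])
qed

lemma continuous_map_pow_topD:
  fixes f :: "(nat \<Rightarrow> 'a::{linordered_ab_group_add, linorder_topology}) \<Rightarrow> 'a"
  assumes "continuous_map (subtopology (pow_top n) S) euclidean f" "S \<subseteq> pow_set n" "x \<in> S" "0 < e"
  obtains d where "0 < d" "\<And>y. y \<in> S \<Longrightarrow> box_dist n x y < d \<Longrightarrow> f x - f y < e \<and> f y - f x < e"
proof -
  have "openin (subtopology (pow_top n) S)
      {y \<in> topspace (subtopology (pow_top n) S). f y \<in> {f x - e<..<f x + e}}"
    by (rule openin_continuous_map_preimage[OF assms(1)]) simp
  then obtain V where V: "openin (pow_top n) V"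
    "{y \<in> topspace (subtopology (pow_top n) S). f y \<in> {f x - e<..<f x + e}} = V \<inter> S"
    unfolding openin_subtopology by blast
  have "x \<in> {y \<in> topspace (subtopology (pow_top n) S). f y \<in> {f x - e<..<f x + e}}"
    using assms(2-4) by auto
  then have "x \<in> V" using V(2) by blast
  with V(1) have "\<exists>d>0. \<forall>y\<in>pow_set n. box_dist n x y < d \<longrightarrow> y \<in> V"
    by (simp only: openin_pow_top_iff[OF assms(4)])
  then obtain d where d: "0 < d" "\<And>y. y \<in> pow_set n \<Longrightarrow> box_dist n x y < d \<Longrightarrow> y \<in> V"
    by auto
  have "f x - f y < e \<and> f y - f x < e" if "y \<in> S" "box_dist n x y < d" for y
  proof -
    have "y \<in> V \<inter> S" using d(2) that assms(2) by blast
    then have "f y \<in> {f x - e<..<f x + e}" using V(2) by blast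
    then show ?thesis by (simp add: algebra_simps)
  qed
  with d(1) show thesis by (rule that)
qed

lemma continuous_map_pow_topI:
  fixes g :: "(nat \<Rightarrow> 'a::{linordered_ab_group_add, linorder_topology}) \<Rightarrow> 'a"
  assumes "(0::'a) < e\<^sub>0"
    and g: "\<And>x e. x \<in> pow_set n \<Longrightarrow> 0 < e \<Longrightarrow>
      \<exists>d>0. \<forall>y\<in>pow_set n. box_dist n x y < d \<longrightarrow> g x - g y < e \<and> g y - g x < e"
  shows "continuous_map (pow_top n) euclidean g"
  unfolding continuous_map openin_pow_top_iff[OF assms(1)]
proof (intro conjI allI impI ballI)
  fix U x assume "openin euclidean U" and x: "x \<in> {x \<in> topspace (pow_top n). g x \<in> U}"
  then have "open U" "x \<in> pow_set n" "g x \<in> U" by simp_all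
  then obtain e where e: "0 < e" "\<And>z. g x - z < e \<Longrightarrow> z - g x < e \<Longrightarrow> z \<in> U"
    using open_contains_interval assms(1) by metis
  obtain d where "0 < d"
    "\<And>y. y \<in> pow_set n \<Longrightarrow> box_dist n x y < d \<Longrightarrow> g x - g y < e \<and> g y - g x < e"
    using g[OF \<open>x \<in> pow_set n\<close> e(1)] by auto
  then show "\<exists>d>0. \<forall>y\<in>pow_set n. box_dist n x y < d \<longrightarrow> y \<in> {x \<in> topspace (pow_top n). g x \<in> U}"
    using e(2) by (intro exI[of _ d]) simp
qed auto

section \<open>Boundedness of definable continuous functions\<close>

text \<open>A substitute for compactness. The sets of points of \<open>S\<close> with
  \<open>t \<le> F x\<close> are nonempty and shrink as \<open>t\<close> grows; each new coordinate
  of \<open>c\<close> is the limit superior of that coordinate along these sets, restricted to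
  points close to the coordinates already chosen.\<close>

lemma unbounded_cluster_point:
  fixes \<M> :: "('f, 'r, 'a::linordered_ab_group_add) expansion"
  assumes complete: "definably_complete \<M>" and S: "definable \<M> n S"
    and box: "S \<subseteq> {..<n} \<rightarrow>\<^sub>E {a<..<b}"
    and F: "deffun \<M> (\<lambda>w. F (\<lambda>i\<in>{..<n}. w i))"
    and unbounded: "\<And>t. \<exists>x\<in>S. t \<le> F x"
    and "k \<le> n"
  shows "\<exists>c. \<forall>t e. 0 < e \<longrightarrow> (\<exists>x\<in>S. t \<le> F x \<and> (\<forall>i<k. c i - x i \<le> e \<and> x i - c i \<le> e))"
  using \<open>k \<le> n\<close>
proof (induction k)
  case 0
  then show ?case using unbounded by simp
next
  case (Suc k)
  then obtain c where c: "\<And>t e. 0 < e \<Longrightarrow>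
      \<exists>x\<in>S. t \<le> F x \<and> (\<forall>i<k. c i - x i \<le> e \<and> x i - c i \<le> e)"
    by auto
  have xk: "a < x k" "x k < b" if "x \<in> S" for x
    using subsetD[OF box that] Suc.prems by (auto simp: PiE_iff)
  \<comment> \<open>The set of eventual upper bounds of coordinate \<open>k\<close>; its infimum is
    the limit superior.\<close>
  define X where "X = {z. \<exists>t e. 0 < e \<and> (\<forall>x\<in>pow_set n. x \<in> S \<longrightarrow> t \<le> F x \<longrightarrow>
      (\<forall>i<k. c i - x i \<le> e \<and> x i - c i \<le> e) \<longrightarrow> x k \<le> z)}"
  have "defpred \<M> (\<lambda>v. \<exists>t e. 0 < e \<and> (\<forall>x\<in>pow_set n. x \<in> S \<longrightarrow> t \<le> F x \<longrightarrow>
      (\<forall>i<k. c i - x i \<le> e \<and> x i - c i \<le> e) \<longrightarrow> x k \<le> v 0))"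
    using Suc.prems
    by (intro defpred_ex defpred_conj defpred_all_tuple defpred_imp defpred_mem[OF S] defpred_less
        defpred_le defpred_all_less deffun_minus deffun_const deffun_var F)
      (simp_all add: deffun_var)
  then have def: "definable1 \<M> X" by (simp only: definable1_iff_defpred X_def mem_Collect_eq)
  have X_iff: "z \<in> X \<longleftrightarrow> (\<exists>t e. 0 < e \<and> (\<forall>x\<in>S. t \<le> F x \<longrightarrow>
      (\<forall>i<k. c i - x i \<le> e \<and> x i - c i \<le> e) \<longrightarrow> x k \<le> z))" for z
  proof -
    have "(\<forall>x\<in>pow_set n. x \<in> S \<longrightarrow> Q x) \<longleftrightarrow> (\<forall>x\<in>S. Q x)" for Q
      using definable_subset_pow_set[OF S] by blast
    then show ?thesis by (simp only: X_def mem_Collect_eq)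
  qed
  obtain x\<^sub>0 where "x\<^sub>0 \<in> S" using unbounded by blast
  then have "0 < b - a" using xk[of x\<^sub>0] by auto
  then have "b \<in> X" unfolding X_iff using xk by (blast intro: less_imp_le)
  moreover have "a \<le> z" if "z \<in> X" for z
    using that c xk unfolding X_iff by (meson less_imp_le order_trans)
  ultimately obtain z where z: "isGlb UNIV X z"
    using definably_complete_isGlb[OF complete def, of a] by blast
  have "\<exists>x\<in>S. t \<le> F x \<and> (\<forall>i<Suc k. (c(k := z)) i - x i \<le> e \<and> x i - (c(k := z)) i \<le> e)"
    if e: "0 < e" for t e
  proof -
    \<comment> \<open>Some eventual bound \<open>z'\<close> lies below \<open>z + e\<close>, and
      \<open>z - e\<close> is not an eventual bound. A point that refutes \<open>z - e\<close>
      beyond the larger threshold and within the smaller radius also obeys \<open>z'\<close>, so its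
      coordinate \<open>k\<close> is within \<open>e\<close> of \<open>z\<close>.\<close>
    have "\<not> z + e \<le> z" using e by simp
    then obtain z' where z': "z' \<in> X" "z' < z + e"
      using z unfolding isGlb_UNIV_iff by (meson not_le)
    then obtain t' e' where e': "0 < e'" "\<And>x. x \<in> S \<Longrightarrow> t' \<le> F x \<Longrightarrow>
        (\<forall>i<k. c i - x i \<le> e' \<and> x i - c i \<le> e') \<Longrightarrow> x k \<le> z'"
      unfolding X_iff by blast
    have "\<not> z \<le> z - e" using e by simp
    then have "z - e \<notin> X" using z unfolding isGlb_UNIV_iff by blast
    moreover have "0 < min e e'" using e e' by simp
    ultimately obtain x where x: "x \<in> S" "max t t' \<le> F x" "\<not> x k \<le> z - e"
      "\<forall>i<k. c i - x i \<le> min e e' \<and> x i - c i \<le> min e e'"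
      unfolding X_iff by blast
    have "x k \<le> z'" using e'(2)[OF x(1)] x(2,4) by simp
    then have "x k - z \<le> e" using z'(2) by (simp add: algebra_simps)
    moreover have "z - x k \<le> e" using x(3) by (simp add: algebra_simps)
    ultimately show ?thesis using x by (intro bexI[of _ x]) (auto simp: less_Suc_eq)
  qed
  then show ?case by blast
qed

text \<open>If \<open>f\<close> were unbounded, the cluster point of the sets where its absolute
  value is large would lie in the closed set \<open>S\<close>, and continuity at that point would
  bound \<open>f\<close> nearby.\<close>

lemma definable_continuous_bounded:
  fixes \<M> :: "('f, 'r, 'a::{linordered_ab_group_add, dense_linorder, linorder_topology}) expansion"
  assumes complete: "definably_complete \<M>" and S: "definable \<M> n S"
    and closed: "closedin (pow_top n) S" and box: "S \<subseteq> {..<n} \<rightarrow>\<^sub>E {a<..<b}"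
    and f: "definable_fun \<M> n S f"
    and cont: "continuous_map (subtopology (pow_top n) S) euclidean f"
    and e\<^sub>0: "(0::'a) < e\<^sub>0"
  obtains B where "0 < B" "\<And>x. x \<in> S \<Longrightarrow> - B \<le> f x \<and> f x \<le> B"
proof -
  \<comment> \<open>The absolute value of \<open>f\<close>, set to 0 off \<open>S\<close>; writing
    \<open>0 - y\<close> lets the rule for differences apply.\<close>
  define F where "F x = (let y = if x \<in> S then f x else 0 in max y (0 - y))" for x
  have F: "deffun \<M> (\<lambda>w. F (\<lambda>i\<in>{..<n}. w i))"
    unfolding F_def Let_def
    by (intro deffun_max deffun_minus deffun_const deffun_extend_zero[OF f S])
  have "\<exists>t. \<forall>x\<in>S. F x < t"
  proof (rule ccontr)
    assume "\<not> ?thesis"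
    then have "\<exists>x\<in>S. t \<le> F x" for t by (meson not_le)
    from unbounded_cluster_point[OF complete S box F this order_refl]
    obtain c where c: "\<And>t e. 0 < e \<Longrightarrow>
        \<exists>x\<in>S. t \<le> F x \<and> (\<forall>i<n. c i - x i \<le> e \<and> x i - c i \<le> e)"
      by auto
    define y where "y = (\<lambda>i\<in>{..<n}. c i)"
    have y: "\<exists>x\<in>S. t \<le> F x \<and> box_dist n y x < e" if e: "0 < e" for t e
    proof -
      obtain e' where e': "0 < e'" "e' < e" using dense[OF e] by blast
      obtain x where x: "x \<in> S" "t \<le> F x" "\<forall>i<n. c i - x i \<le> e' \<and> x i - c i \<le> e'"
        using c[OF e'(1)] by blast
      have "box_dist n y x \<le> e'" using x(3) e'(1) by (simp add: box_dist_le_iff y_def)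
      then show ?thesis using x e'(2) by (meson le_less_trans)
    qed
    have "y \<in> S"
    proof (rule ccontr)
      assume "y \<notin> S"
      moreover have "y \<in> pow_set n" by (simp add: y_def)
      ultimately obtain e where "0 < e" "\<And>x. x \<in> S \<Longrightarrow> e \<le> box_dist n y x"
        using closedin_pow_top_separated[OF e\<^sub>0 closed] by blast
      then show False using y by (meson not_le)
    qed
    then obtain d where d: "0 < d" "\<And>x. x \<in> S \<Longrightarrow> box_dist n y x < d \<Longrightarrow> f y - f x < e\<^sub>0 \<and> f x - f y < e\<^sub>0"
      using continuous_map_pow_topD[OF cont definable_subset_pow_set[OF S] _ e\<^sub>0] by metis
    \<comment> \<open>The threshold is exactly the bound that continuity at \<open>y\<close> puts on
      the absolute value of \<open>f\<close> near \<open>y\<close>.\<close>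
    obtain x where x: "x \<in> S" "max (f y + e\<^sub>0) (e\<^sub>0 - f y) \<le> F x" "box_dist n y x < d"
      using y[OF d(1)] by blast
    have "f x < f y + e\<^sub>0" "- f x < e\<^sub>0 - f y" using d(2)[OF x(1,3)] by (simp_all add: algebra_simps)
    then have "F x < max (f y + e\<^sub>0) (e\<^sub>0 - f y)"
      using x(1) by (auto simp: F_def Let_def less_max_iff_disj)
    then show False using x(2) by (meson not_le)
  qed
  then obtain t where t: "\<And>x. x \<in> S \<Longrightarrow> F x < t" by blast
  show thesis
  proof (rule that)
    show "0 < max t e\<^sub>0" using e\<^sub>0 by (simp add: less_max_iff_disj)
    fix x assume "x \<in> S"
    then have "f x < t" "- f x < t" using t[of x] by (auto simp: F_def Let_def)
    then have "f x \<le> max t e\<^sub>0" "- f x \<le> max t e\<^sub>0" by (auto simp: le_max_iff_disj)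
    then show "- max t e\<^sub>0 \<le> f x \<and> f x \<le> max t e\<^sub>0" using minus_le_iff by blast
  qed
qed

section \<open>Extension by Riesz's formula\<close>

locale ordered_field_mult =
  fixes u :: "'a::linordered_ab_group_add" and m :: "'a \<Rightarrow> 'a \<Rightarrow> 'a"
  assumes ordered_field: "ordered_field_on u m"
begin

text \<open>The product is a bare function on the ordered group, so its laws are extracted from the
  algebraic field structure. Division appears only as the existence of quotients.\<close>

lemma m_commute: "m x y = m y x"
  and m_add_left: "m (x + y) z = m x z + m y z"
  and m_divide: "z \<noteq> 0 \<Longrightarrow> \<exists>y. m y z = x"
  and m_pos: "0 < x \<Longrightarrow> 0 < y \<Longrightarrow> 0 < m x y"
proof -
  interpret F: field "\<lparr>carrier = UNIV, monoid.mult = m, one = u, zero = 0::'a, add = (+)\<rparr>"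
    using ordered_field unfolding ordered_field_on_def by blast
  show "m x y = m y x" using F.m_comm[of x y] by simp
  show "m (x + y) z = m x z + m y z" using F.l_distr[of x y z] by simp
  show "\<exists>y. m y z = x" if "z \<noteq> 0"
  proof -
    have "z \<in> Units \<lparr>carrier = UNIV, monoid.mult = m, one = u, zero = 0::'a, add = (+)\<rparr>"
      using F.field_Units that by simp
    then obtain w where "m w z = u" using F.Units_l_inv_ex[of z] by auto
    then have "m (m x w) z = x" using F.m_assoc[of x w z] F.r_one[of x] by simp
    then show ?thesis by blast
  qed
  show "0 < x \<Longrightarrow> 0 < y \<Longrightarrow> 0 < m x y"
    using ordered_field unfolding ordered_field_on_def by blast
qed

lemma positive_exists: "\<exists>e::'a. 0 < e"
proof -
  interpret F: field "\<lparr>carrier = UNIV, monoid.mult = m, one = u, zero = 0, add = (+)\<rparr>"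
    using ordered_field unfolding ordered_field_on_def by blast
  have "u \<noteq> 0" using F.one_not_zero by simp
  then have "0 < u \<or> 0 < - u" by auto
  then show ?thesis by blast
qed

lemma m_add_right: "m x (y + z) = m x y + m x z"
  using m_add_left[of y z x] by (simp add: m_commute)

lemma m_diff_left: "m (x - y) z = m x z - m y z"
  using m_add_left[of "x - y" y z] by simp

lemma m_diff_right: "m x (y - z) = m x y - m x z"
  using m_diff_left[of y z x] by (simp add: m_commute)

lemma m_zero_left: "m 0 x = 0"
  using m_diff_left[of 0 0 x] by simp

lemma m_less: "x < y \<Longrightarrow> 0 < z \<Longrightarrow> m x z < m y z"
  using m_pos[of "y - x" z] by (simp add: m_diff_left)

lemma m_le_left: "x \<le> y \<Longrightarrow> 0 \<le> z \<Longrightarrow> m x z \<le> m y z"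
  using m_less[of x y z] m_zero_left[of x] m_zero_left[of y] m_commute
  by (metis order.order_iff_strict)

lemma m_le_right: "x \<le> y \<Longrightarrow> 0 \<le> z \<Longrightarrow> m z x \<le> m z y"
  using m_le_left m_commute by metis

lemma m_mono: "x \<le> x' \<Longrightarrow> y \<le> y' \<Longrightarrow> 0 \<le> y \<Longrightarrow> 0 \<le> x' \<Longrightarrow> m x y \<le> m x' y'"
  using m_le_left m_le_right order_trans by metis

lemma m_le_cancel: "m x z \<le> m y z \<Longrightarrow> 0 < z \<Longrightarrow> x \<le> y"
  using m_less[of y x z] by (meson not_le)

lemma m_less_cancel: "m x z < m y z \<Longrightarrow> 0 < z \<Longrightarrow> x < y"
  using m_le_left[of y x z] by (meson not_le less_imp_le)

lemma m_double: "m (p + p) x = m p (x + x)"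
  by (simp add: m_add_left m_add_right)

end

text \<open>The analytic core, separated from definability: \<open>\<delta>\<close> is the distance
  to \<open>S\<close>, \<open>h\<close> the numerator in Riesz's formula, and \<open>G\<close> their
  quotient, specified by its product with \<open>\<delta>\<close>. The infima are only assumed on
  \<open>K\<close>, which will be a box containing \<open>S\<close>.\<close>

locale riesz_extension = ordered_field_mult u m
  for u :: "'a::{linordered_ab_group_add, dense_linorder}" and m +
  fixes d :: "'b \<Rightarrow> 'b \<Rightarrow> 'a" and S K :: "'b set" and F \<delta> h G :: "'b \<Rightarrow> 'a" and p :: 'a
  assumes d_nonneg: "0 \<le> d x y" and d_commute: "d x y = d y x"
    and d_triangle: "d x z \<le> d x y + d y z"
    and p_pos: "0 < p" and S_ne: "S \<noteq> {}"
    and F_ge: "y \<in> S \<Longrightarrow> p \<le> F y" and F_le: "y \<in> S \<Longrightarrow> F y \<le> p + p"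
    and F_cont: "x \<in> S \<Longrightarrow> 0 < e \<Longrightarrow>
      \<exists>r>0. \<forall>y\<in>S. d x y < r \<longrightarrow> F x - F y < e \<and> F y - F x < e"
    and \<delta>: "x \<in> K \<Longrightarrow> isGlb UNIV (d x ` S) (\<delta> x)"
    and h: "x \<in> K \<Longrightarrow> isGlb UNIV ((\<lambda>y. m (F y) (d x y)) ` S) (h x)"
    and \<delta>_pos: "x \<in> K \<Longrightarrow> x \<notin> S \<Longrightarrow> 0 < \<delta> x"
    and G_eq: "x \<in> S \<Longrightarrow> G x = F x"
    and G_mult: "x \<in> K \<Longrightarrow> x \<notin> S \<Longrightarrow> m (G x) (\<delta> x) = h x"
begin

lemma F_pos: "y \<in> S \<Longrightarrow> 0 < F y"
  using F_ge p_pos by (metis less_le_trans)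

lemma \<delta>_le: "x \<in> K \<Longrightarrow> y \<in> S \<Longrightarrow> \<delta> x \<le> d x y"
  using \<delta> by (simp add: isGlb_UNIV_iff)

lemma \<delta>_greatest: "x \<in> K \<Longrightarrow> (\<And>y. y \<in> S \<Longrightarrow> c \<le> d x y) \<Longrightarrow> c \<le> \<delta> x"
  using \<delta> by (simp add: isGlb_UNIV_iff)

lemma h_le: "x \<in> K \<Longrightarrow> y \<in> S \<Longrightarrow> h x \<le> m (F y) (d x y)"
  using h by (simp add: isGlb_UNIV_iff)

lemma h_greatest: "x \<in> K \<Longrightarrow> (\<And>y. y \<in> S \<Longrightarrow> c \<le> m (F y) (d x y)) \<Longrightarrow> c \<le> h x"
  using h by (simp add: isGlb_UNIV_iff)

lemma \<delta>_nonneg: "x \<in> K \<Longrightarrow> 0 \<le> \<delta> x"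
  using \<delta>_greatest d_nonneg by blast

lemma \<delta>_Lipschitz: "x \<in> K \<Longrightarrow> x' \<in> K \<Longrightarrow> \<delta> x - d x x' \<le> \<delta> x'"
proof (rule \<delta>_greatest)
  fix y assume "x \<in> K" "y \<in> S"
  then have "\<delta> x \<le> d x x' + d x' y" using \<delta>_le d_triangle order_trans by blast
  then show "\<delta> x - d x x' \<le> d x' y" by (simp add: algebra_simps)
qed

text \<open>The triangle inequality is weighted by \<open>F y\<close>, whose upper bound gives the
  constant \<open>p + p\<close>. The opposite estimate follows by exchanging the points.\<close>

lemma h_Lipschitz: "x \<in> K \<Longrightarrow> x' \<in> K \<Longrightarrow> h x - m (p + p) (d x x') \<le> h x'"
proof (rule h_greatest)
  fix y assume "x \<in> K" and y: "y \<in> S"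
  then have "h x \<le> m (F y) (d x y)" by (rule h_le)
  also have "\<dots> \<le> m (F y) (d x x' + d x' y)"
    using d_triangle F_pos[OF y] by (intro m_le_right) auto
  also have "\<dots> = m (F y) (d x x') + m (F y) (d x' y)" by (rule m_add_right)
  also have "\<dots> \<le> m (p + p) (d x x') + m (F y) (d x' y)"
    using m_le_left[OF F_le[OF y] d_nonneg] by simp
  finally show "h x - m (p + p) (d x x') \<le> m (F y) (d x' y)" by (simp add: algebra_simps)
qed

text \<open>Multiplication by a positive \<open>c\<close> commutes with infima: the quotient of
  \<open>h x\<close> by \<open>c\<close> is a lower bound of the distances, hence at most
  \<open>\<delta> x\<close>.\<close>

lemma h_le_mult:
  assumes "x \<in> K" "0 < c" "\<And>y. y \<in> S \<Longrightarrow> h x \<le> m c (d x y)"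
  shows "h x \<le> m c (\<delta> x)"
proof -
  obtain q where q: "m q c = h x" using m_divide[of c] assms(2) by blast
  have "q \<le> \<delta> x"
  proof (rule \<delta>_greatest[OF assms(1)])
    fix y assume "y \<in> S"
    then have "m q c \<le> m (d x y) c" using assms(3) q m_commute by metis
    then show "q \<le> d x y" using assms(2) by (rule m_le_cancel)
  qed
  then show ?thesis using m_le_left[of q "\<delta> x" c] assms(2) q m_commute by auto
qed

lemma h_ge: "x \<in> K \<Longrightarrow> m p (\<delta> x) \<le> h x"
  using F_ge F_pos \<delta>_le \<delta>_nonneg by (intro h_greatest m_mono) (auto intro: less_imp_le)

lemma h_le_double: "x \<in> K \<Longrightarrow> h x \<le> m (p + p) (\<delta> x)"
proof (rule h_le_mult)
  show "0 < p + p" using p_pos by (simp add: add_pos_pos)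
  fix y assume "x \<in> K" "y \<in> S"
  then show "h x \<le> m (p + p) (d x y)"
    using h_le m_le_left[OF F_le d_nonneg] order_trans by blast
qed

lemma G_bounds: assumes "x \<in> K" shows "p \<le> G x \<and> G x \<le> p + p"
proof (cases "x \<in> S")
  case False
  then show ?thesis
    using h_ge h_le_double \<delta>_pos G_mult assms m_le_cancel by metis
qed (use F_ge F_le G_eq in auto)

text \<open>For \<open>x'\<close> close to \<open>x\<close>, the points \<open>y\<close> of
  \<open>S\<close> that are far from \<open>x'\<close> cannot spoil the estimates, because
  \<open>F\<close> varies at most by a factor two. The other points are close to \<open>x\<close>,
  where \<open>F y\<close> is close to \<open>F x\<close>.\<close>

lemma G_continuous_at_S:
  assumes x: "x \<in> S" "x \<in> K" and e: "0 < e"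
  shows "\<exists>r>0. \<forall>x'\<in>K. d x x' < r \<longrightarrow> G x - G x' < e \<and> G x' - G x < e"
proof -
  \<comment> \<open>Estimates through infima are not strict; the smaller \<open>e'\<close> restores
    strictness at the end.\<close>
  obtain e' where e': "0 < e'" "e' < e" using dense[OF e] by blast
  obtain s where s: "0 < s" "\<And>y. y \<in> S \<Longrightarrow> d x y < s \<Longrightarrow> F x - F y < e' \<and> F y - F x < e'"
    using F_cont[OF x(1) e'(1)] by blast
  \<comment> \<open>If \<open>x'\<close> is within \<open>r\<close> of \<open>x\<close> and
    \<open>y\<close> within \<open>r + r\<close> of \<open>x'\<close>, then \<open>y\<close> is
    within three times \<open>r\<close> of \<open>x\<close>, which is at most
    \<open>s\<close>.\<close>
  obtain s' where s': "0 < s'" "s' + s' \<le> s" using ordered_group_half[OF s(1)] by blast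
  obtain r where r: "0 < r" "r + r \<le> s'" using ordered_group_half[OF s'(1)] by blast
  have "r \<le> s'" using r by (meson add_increasing2 less_imp_le order_refl order_trans)
  have "G x - G x' \<le> e' \<and> G x' - G x \<le> e'" if x': "x' \<in> K" "d x x' < r" for x'
  proof (cases "x' \<in> S")
    case True
    have "r < s" using r s' by (metis \<open>r \<le> s'\<close> add_strict_increasing less_le_trans order_le_less_trans)
    then show ?thesis using True x x' s(2)[of x'] G_eq by (auto intro: less_imp_le)
  next
    case False
    have \<delta>0: "0 < \<delta> x'" using \<delta>_pos x' False by blast
    have \<delta>r: "\<delta> x' \<le> r" using \<delta>_le[OF x'(1) x(1)] x'(2) d_commute[of x x'] by simp
    have near: "F x - F y < e' \<and> F y - F x < e'" if "y \<in> S" "d x' y < r + r" for y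
    proof -
      have "d x y \<le> d x x' + d x' y" by (rule d_triangle)
      also have "\<dots> < r + (r + r)" using x'(2) that(2) by (rule add_strict_mono)
      also have "\<dots> \<le> s' + s'" using \<open>r \<le> s'\<close> r(2) by (rule add_mono)
      finally show ?thesis using s(2) s'(2) that(1) by auto
    qed
    \<comment> \<open>The distance from \<open>x'\<close> to \<open>S\<close> is at most
      \<open>r\<close>, while \<open>y\<close> is at least twice as far away; this compensates the
      ratio of the bounds \<open>p + p\<close> and \<open>p\<close> on \<open>F\<close>.\<close>
    have far: "m (p + p) (\<delta> x') \<le> m p (d x' y)" if "\<not> d x' y < r + r" for y
    proof -
      have "m (p + p) (\<delta> x') \<le> m (p + p) r"
        using \<delta>r p_pos by (intro m_le_right) (auto simp: add_nonneg_nonneg less_imp_le)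
      also have "\<dots> = m p (r + r)" by (rule m_double)
      also have "\<dots> \<le> m p (d x' y)" using that p_pos by (intro m_le_right) auto
      finally show ?thesis .
    qed
    have "m (F x - e') (\<delta> x') \<le> h x'"
    proof (rule h_greatest[OF x'(1)])
      fix y assume y: "y \<in> S"
      show "m (F x - e') (\<delta> x') \<le> m (F y) (d x' y)"
      proof (cases "d x' y < r + r")
        case True
        then have "F x - e' \<le> F y" using near[OF y] by (simp add: algebra_simps less_imp_le)
        then show ?thesis
          using \<delta>_le[OF x'(1) y] \<delta>0 F_pos[OF y] by (intro m_mono) auto
      next
        case False
        have "F x - e' \<le> p + p" using F_le[OF x(1)] e'(1) by (simp add: add_increasing2 diff_le_eq)
        then have "m (F x - e') (\<delta> x') \<le> m (p + p) (\<delta> x')" using \<delta>0 by (intro m_le_left) auto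
        also have "\<dots> \<le> m p (d x' y)" using far False by blast
        also have "\<dots> \<le> m (F y) (d x' y)" using F_ge[OF y] d_nonneg by (rule m_le_left)
        finally show ?thesis .
      qed
    qed
    then have "F x - e' \<le> G x'" using G_mult[OF x'(1) False] \<delta>0 m_le_cancel by metis
    moreover have "h x' \<le> m (F x + e') (\<delta> x')"
    proof (rule h_le_mult[OF x'(1)])
      show "0 < F x + e'" using F_pos[OF x(1)] e'(1) by (rule add_pos_pos)
      fix y assume y: "y \<in> S"
      show "h x' \<le> m (F x + e') (d x' y)"
      proof (cases "d x' y < r + r")
        case True
        then have "F y \<le> F x + e'" using near[OF y] by (simp add: algebra_simps less_imp_le)
        then show ?thesis using h_le[OF x'(1) y] m_le_left d_nonneg order_trans by blast
      next
        case False
        have "p \<le> F x + e'" using F_ge[OF x(1)] e'(1) by (simp add: add_increasing2)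
        then show ?thesis
          using h_le_double[OF x'(1)] far[OF False] m_le_left d_nonneg order_trans by metis
      qed
    qed
    then have "G x' \<le> F x + e'" using G_mult[OF x'(1) False] \<delta>0 m_le_cancel by metis
    ultimately show ?thesis using G_eq[OF x(1)] by (simp add: algebra_simps)
  qed
  then show ?thesis using r(1) e'(2) le_less_trans by blast
qed

lemma G_continuous_off_S:
  assumes x: "x \<notin> S" "x \<in> K" and e: "0 < e"
  shows "\<exists>r>0. \<forall>x'\<in>K. d x x' < r \<longrightarrow> G x - G x' < e \<and> G x' - G x < e"
proof -
  have g: "0 < G x" using G_bounds[OF x(2)] p_pos by auto
  have \<delta>0: "0 < \<delta> x" using \<delta>_pos x by blast
  \<comment> \<open>With \<open>t = d x x'\<close>, the numerator moves by at most
    \<open>p + p\<close> times \<open>t\<close>, and a change of the denominator by \<open>t\<close>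
    costs \<open>G x + e\<close> times \<open>t\<close>. The radius \<open>s\<close> is the quotient
    of \<open>m e (\<delta> x)\<close> by the total rate \<open>A\<close>; the further bound
    \<open>\<delta> x\<close> on the radius keeps \<open>x'\<close> off \<open>S\<close>.\<close>
  define A where "A = p + p + (G x + e)"
  have A: "0 < A" using p_pos g e by (simp add: A_def add_pos_pos)
  obtain s where s: "m s A = m e (\<delta> x)" using m_divide[of A] A by blast
  have "0 < s" using m_pos[OF e \<delta>0] m_less_cancel[of 0 A s] A s m_zero_left by metis
  have "G x - G x' < e \<and> G x' - G x < e" if x': "x' \<in> K" "d x x' < min s (\<delta> x)" for x'
  proof -
    define t where "t = d x x'"
    have t: "0 \<le> t" "t < \<delta> x" using d_nonneg x'(2) by (auto simp: t_def)
    have "x' \<notin> S" using \<delta>_le[OF x(2), of x'] x'(2) by auto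
    then have \<delta>0': "0 < \<delta> x'" using \<delta>_pos x' by blast
    have "m t A < m e (\<delta> x)" using m_less[of t s A] x'(2) A s by (simp add: t_def)
    then have small: "m (p + p) t + m (G x + e) t < m e (\<delta> x)"
      by (simp only: A_def m_commute[of t] m_add_left)
    have \<delta>1: "\<delta> x - t \<le> \<delta> x'" using \<delta>_Lipschitz[OF x(2) x'(1)] by (simp add: t_def)
    have \<delta>2: "\<delta> x' \<le> \<delta> x + t"
      using \<delta>_Lipschitz[OF x'(1) x(2)] d_commute[of x x'] by (simp add: t_def algebra_simps)
    have h1: "h x - m (p + p) t \<le> h x'" using h_Lipschitz[OF x(2) x'(1)] by (simp add: t_def)
    have h2: "h x' \<le> h x + m (p + p) t"
      using h_Lipschitz[OF x'(1) x(2)] d_commute[of x x'] by (simp add: t_def algebra_simps)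
    have Gx: "h x = m (G x) (\<delta> x)" using G_mult x by simp
    note h2
    also have "h x + m (p + p) t < h x + (m e (\<delta> x) - m (G x + e) t)"
      using small by (simp add: algebra_simps)
    also have "\<dots> = m (G x + e) (\<delta> x - t)"
      by (simp add: Gx m_add_left m_diff_right algebra_simps)
    also have "\<dots> \<le> m (G x + e) (\<delta> x')"
      using \<delta>1 g e by (intro m_le_right) (auto simp: add_nonneg_nonneg less_imp_le)
    finally have "G x' < G x + e" using G_mult[OF x'(1) \<open>x' \<notin> S\<close>] \<delta>0' m_less_cancel by metis
    moreover have "m (G x - e) (\<delta> x') < h x'"
    proof -
      \<comment> \<open>The factor \<open>G x - e\<close> may be negative, so the two products are
        estimated separately, from opposite bounds on \<open>\<delta> x'\<close>.\<close>
      have "m (G x - e) (\<delta> x') = m (G x) (\<delta> x') - m e (\<delta> x')" by (rule m_diff_left)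
      also have "\<dots> \<le> m (G x) (\<delta> x + t) - m e (\<delta> x - t)"
        using \<delta>1 \<delta>2 g e by (intro diff_mono m_le_right) auto
      also have "\<dots> = h x - m (p + p) t + ((m (p + p) t + m (G x + e) t) - m e (\<delta> x))"
        by (simp add: Gx m_add_left m_add_right m_diff_right algebra_simps)
      also have "\<dots> < h x - m (p + p) t"
        using small by (simp only: add_less_same_cancel1 less_iff_diff_less_0[symmetric])
      also note h1
      finally show ?thesis .
    qed
    then have "G x - e < G x'" using G_mult[OF x'(1) \<open>x' \<notin> S\<close>] \<delta>0' m_less_cancel by metis
    ultimately show ?thesis by (simp add: algebra_simps)
  qed
  then show ?thesis using \<open>0 < s\<close> \<delta>0 by (intro exI[of _ "min s (\<delta> x)"]) auto
qed

end

section \<open>Definability of the extension\<close>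

definition clamp :: "nat \<Rightarrow> 'a \<Rightarrow> 'a \<Rightarrow> (nat \<Rightarrow> 'a) \<Rightarrow> nat \<Rightarrow> 'a::linorder" where
  "clamp n a b x = (\<lambda>i\<in>{..<n}. max a (min b (x i)))"

lemma clamp_diff_le:
  fixes a b c :: "'a::linordered_ab_group_add"
  assumes "x - y \<le> c" "0 \<le> c"
  shows "max a (min b x) - max a (min b y) \<le> c"
proof -
  have "b \<le> c + b" "x \<le> c + y" using assms by (simp_all add: algebra_simps)
  then have "min b x \<le> c + min b y" by (simp add: min_add_distrib_right min_le_iff_disj)
  also have "\<dots> \<le> c + max a (min b y)" by simp
  finally have "max a (min b x) \<le> c + max a (min b y)"
    using assms(2) by (simp add: add_increasing)
  then show ?thesis by (simp add: diff_le_eq)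
qed

text \<open>The retraction does not increase distances in any coordinate, so a radius that witnesses
  continuity on the box also works after composition with it.\<close>

lemma box_dist_clamp: "box_dist n (clamp n a b x) (clamp n a b y) \<le> box_dist n x y"
  using box_dist_le_iff[of n x y "box_dist n x y"]
  by (simp add: box_dist_le_iff clamp_def clamp_diff_le)

text \<open>Only the product on a bounded square is definable. The default value 0 outside the
  square makes it a total definable operation into which terms can be substituted.\<close>

lemma deffun_bounded_mult:
  fixes \<M> :: "('f, 'r, 'a::linordered_ab_group_add) expansion"
  assumes "definable_fun \<M> 2 ({..<2} \<rightarrow>\<^sub>E {a<..<b}) (\<lambda>x. m (x 0) (x 1))"
    and s: "deffun \<M> s" and t: "deffun \<M> t"
  shows "deffun \<M> (\<lambda>v. if a < s v \<and> s v < b \<and> a < t v \<and> t v < b then m (s v) (t v) else 0)"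
proof (rule deffun_subst2[of \<M> "\<lambda>x y. if a < x \<and> x < b \<and> a < y \<and> y < b then m x y else 0", OF _ s t])
  have "defpred \<M> (\<lambda>v. (\<lambda>i\<in>{..<2}. v i) \<in> {..<2} \<rightarrow>\<^sub>E {a<..<b} \<and>
      v 2 = m ((\<lambda>i\<in>{..<2}. v i) 0) ((\<lambda>i\<in>{..<2}. v i) 1))"
    by (rule iffD1[OF definable_fun_iff_defpred assms(1)]) auto
  moreover have "(\<lambda>i\<in>{..<2}. v i) \<in> {..<2} \<rightarrow>\<^sub>E {a<..<b} \<longleftrightarrow>
      a < v 0 \<and> v 0 < b \<and> a < v 1 \<and> v 1 < b" for v :: "nat \<Rightarrow> 'a"
    by (auto simp: PiE_iff less_2_cases_iff)
  ultimately have "defpred \<M> (\<lambda>v. (a < v 0 \<and> v 0 < b \<and> a < v 1 \<and> v 1 < b) \<and> v 2 = m (v 0) (v 1))"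
    by simp
  from defpred_rename[OF this, of "\<lambda>i. if i = 2 then 0 else Suc i"]
  have mult: "defpred \<M> (\<lambda>v. (a < v 1 \<and> v 1 < b \<and> a < v 2 \<and> v 2 < b) \<and> v 0 = m (v 1) (v 2))"
    by (simp add: numeral_2_eq_2)
  have "defpred \<M> (\<lambda>v. a < v 1 \<and> v 1 < b \<and> a < v 2 \<and> v 2 < b)"
    by (intro defpred_conj defpred_less deffun_const deffun_var)
  moreover have "defpred \<M> (\<lambda>v. v 0 = 0)" by (intro defpred_eq deffun_const deffun_var)
  ultimately have "defpred \<M> (\<lambda>v. ((a < v 1 \<and> v 1 < b \<and> a < v 2 \<and> v 2 < b) \<and> v 0 = m (v 1) (v 2)) \<or>
      \<not> (a < v 1 \<and> v 1 < b \<and> a < v 2 \<and> v 2 < b) \<and> v 0 = 0)"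
    using mult by - (rule defpred_disj defpred_not | assumption | rule defpred_conj)+
  moreover have "z = (if P then x else y) \<longleftrightarrow> P \<and> z = x \<or> \<not> P \<and> z = y" for P and x y z :: 'a
    by auto
  ultimately show "defpred \<M> (\<lambda>w. w 0 =
      (if a < w 1 \<and> w 1 < b \<and> a < w 2 \<and> w 2 < b then m (w 1) (w 2) else 0))"
    by (simp only:)
qed

theorem theorem4p7:
  fixes \<M> :: "('f, 'r, 'a::{linordered_ab_group_add, dense_linorder, linorder_topology}) expansion"
    and n :: nat
    and S :: "(nat \<Rightarrow> 'a) set"
    and f :: "(nat \<Rightarrow> 'a) \<Rightarrow> 'a"
  assumes "definably_complete \<M>"
    and "locally_o_minimal \<M>"
    and "definable_bounded_multiplication \<M>"
    and "definable \<M> n S"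
    and "closedin (pow_top n) S"
    and "bounded_in_pow n S"
    and "definable_fun \<M> n S f"
    and "continuous_map (subtopology (pow_top n) S) euclidean f"
  shows "\<exists>g. definable_fun \<M> n (pow_set n) g \<and>
    continuous_map (pow_top n) euclidean g \<and>
    (\<forall>x\<in>S. g x = f x)"
proof (cases "S = {}")
  \<comment> \<open>Infima over the empty set are not elements of the group, so this case is settled
    by the zero function.\<close>
  case True
  have "defpred \<M> (\<lambda>v. (\<lambda>i\<in>{..<n}. v i) \<in> pow_set n \<and> v n = 0)"
    by (intro defpred_conj defpred_eq deffun_var deffun_const) (simp add: defpred_const)
  then have "definable_fun \<M> n (pow_set n) (\<lambda>_. 0)"
    by (simp only: definable_fun_iff_defpred[OF order_refl])
  then show ?thesis using True by (intro exI[of _ "\<lambda>_. 0"]) simp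
next
  case False
  note complete = assms(1) and S = assms(4) and closed = assms(5) and f = assms(7)
    and cont = assms(8)
  note S_pow = definable_subset_pow_set[OF S]
  obtain u m where "ordered_field_on u m"
    and mult: "\<And>a b. a < b \<Longrightarrow>
      definable_fun \<M> 2 ({..<2} \<rightarrow>\<^sub>E {a<..<b}) (\<lambda>x. m (x 0) (x 1))"
    using assms(3) unfolding definable_bounded_multiplication_def by blast
  then interpret ordered_field_mult u m by unfold_locales
  obtain e\<^sub>0 :: 'a where e\<^sub>0: "0 < e\<^sub>0" using positive_exists by blast
  \<comment> \<open>For \<open>n = 0\<close> the inclusion says nothing about the order of the
    endpoints, so \<open>b\<close> is replaced by the maximum.\<close>
  obtain a b where "a \<le> b" and box: "S \<subseteq> {..<n} \<rightarrow>\<^sub>E {a<..<b}"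
  proof -
    obtain a b where "S \<subseteq> {..<n} \<rightarrow>\<^sub>E {a<..<b}" using assms(6) unfolding bounded_in_pow_def by blast
    also have "\<dots> \<subseteq> {..<n} \<rightarrow>\<^sub>E {a<..<max a b}" by (intro PiE_mono) (auto simp: less_max_iff_disj)
    finally show thesis by (rule that[rotated]) simp
  qed
  obtain B where B: "0 < B" "\<And>x. x \<in> S \<Longrightarrow> - B \<le> f x \<and> f x \<le> B"
    using definable_continuous_bounded[OF complete S closed box f cont e\<^sub>0] by blast
  \<comment> \<open>Shifting by \<open>s\<close> moves the range from between \<open>-B\<close> and
    \<open>B\<close> to between \<open>p\<close> and \<open>p + p\<close>. All factors in Riesz's
    formula are values up to \<open>p + p\<close> or distances up to \<open>b - a\<close>, so
    \<open>R\<close> strictly exceeds each of them, and \<open>mb\<close> agrees with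
    \<open>m\<close> wherever it is applied to them.\<close>
  define p s R where "p = B + B" and "s = B + B + B" and "R = p + p + (b - a) + e\<^sub>0"
  define F where "F x = (if x \<in> S then f x else 0) + s" for x
  define K where "K = {x \<in> pow_set n. \<forall>i<n. a \<le> x i \<and> x i \<le> b}"
  define mb where "mb x y = (if - R < x \<and> x < R \<and> - R < y \<and> y < R then m x y else 0)" for x y

  have "0 < p" using B(1) by (simp add: p_def add_pos_pos)
  then have pp: "0 < p + p" by (rule add_pos_pos) fact
  have ba: "0 \<le> b - a" using \<open>a \<le> b\<close> by simp
  have R: "x < R" if "x \<le> p + p" for x
    using that ba e\<^sub>0 unfolding R_def
    by (metis add_increasing2 add_strict_increasing2 le_less_trans less_add_same_cancel1 order.strict_trans1)
  have R': "x < R" if "x \<le> b - a" for x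
    using that pp e\<^sub>0 unfolding R_def
    by (metis add.commute add_strict_increasing2 less_add_same_cancel1 less_imp_le order.strict_trans1 order.strict_trans)
  have R'': "- R < x" if "0 \<le> x" for x
    using that R[of 0] pp by (meson less_imp_le less_le_trans neg_less_0_iff_less)
  have F_bounds: "p \<le> F x" "F x \<le> p + p" if "x \<in> S" for x
  proof -
    have "- B + s \<le> f x + s" "f x + s \<le> B + s" using B(2)[OF that] by simp_all
    then show "p \<le> F x" "F x \<le> p + p" using that by (simp_all add: F_def p_def s_def algebra_simps)
  qed
  have F: "deffun \<M> (\<lambda>v. F (\<lambda>i\<in>{..<n}. v (\<sigma> i)))" for \<sigma>
    unfolding F_def by (intro deffun_plus deffun_extend_zero[OF f S] deffun_const)
  have "- R < R" using R''[of 0] R[of 0] pp by (meson less_imp_le order.strict_trans order_refl)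
  then have mb: "deffun \<M> (\<lambda>v. mb (x v) (y v))" if "deffun \<M> x" "deffun \<M> y" for x y
    unfolding mb_def using that by (intro deffun_bounded_mult mult)
  have dist: "deffun \<M> (\<lambda>v. box_dist n (\<lambda>i\<in>{..<n}. v (\<sigma> i)) (\<lambda>i\<in>{..<n}. v (\<tau> i)))" for \<sigma> \<tau>
    by (intro deffun_box_dist) (simp_all add: deffun_var)

  have dist_le: "box_dist n x y \<le> b - a" if "x \<in> K" "y \<in> S" for x y
  proof -
    have "a \<le> x i \<and> x i \<le> b \<and> a \<le> y i \<and> y i \<le> b" if "i < n" for i
      using \<open>x \<in> K\<close> subsetD[OF box \<open>y \<in> S\<close>] that by (auto simp: K_def PiE_iff less_imp_le)
    then show ?thesis using ba by (simp add: box_dist_le_iff diff_mono)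
  qed
  have mb_eq: "mb (F y) (box_dist n x y) = m (F y) (box_dist n x y)" if "x \<in> K" "y \<in> S" for x y
  proof -
    have "0 \<le> F y" using F_bounds(1)[OF that(2)] \<open>0 < p\<close> by simp
    then show ?thesis
      using R[OF F_bounds(2)[OF that(2)]] R'[OF dist_le[OF that]] R''[of "F y"]
        R''[OF box_dist_nonneg[of n x y]]
      by (simp add: mb_def)
  qed
  have \<delta>_ex: "\<exists>z. isGlb UNIV (box_dist n x ` S) z" for x
  proof -
    have "deffun \<M> (\<lambda>w. box_dist n x (\<lambda>i\<in>{..<n}. w i))"
      by (intro deffun_box_dist) (simp_all add: deffun_var deffun_const)
    from definably_complete_isGlb_image[OF complete S False box_dist_nonneg this]
    show ?thesis by blast
  qed
  have h_ex: "\<exists>z. isGlb UNIV ((\<lambda>y. m (F y) (box_dist n x y)) ` S) z" if x: "x \<in> K" for x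
  proof -
    have "deffun \<M> (\<lambda>w. mb (F (\<lambda>i\<in>{..<n}. w i)) (box_dist n x (\<lambda>i\<in>{..<n}. w i)))"
      by (intro mb F deffun_box_dist) (simp_all add: deffun_var deffun_const)
    moreover have "0 \<le> mb (F y) (box_dist n x y)" if "y \<in> S" for y
    proof -
      have "0 \<le> F y" using F_bounds(1)[OF that] \<open>0 < p\<close> by simp
      then show ?thesis
        using m_le_left[of 0 "F y" "box_dist n x y"] box_dist_nonneg[of n x y] mb_eq[OF x that]
        by (simp add: m_zero_left)
    qed
    ultimately obtain z where "isGlb UNIV ((\<lambda>y. mb (F y) (box_dist n x y)) ` S) z"
      using definably_complete_isGlb_image[OF complete S False, of 0 "\<lambda>y. mb (F y) (box_dist n x y)"]
      by metis
    moreover have "(\<lambda>y. mb (F y) (box_dist n x y)) ` S = (\<lambda>y. m (F y) (box_dist n x y)) ` S"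
      using mb_eq[OF x] by (intro image_cong) auto
    ultimately show ?thesis by auto
  qed
  \<comment> \<open>The distance exists for every \<open>x\<close>, but the numerator is only
    controlled on \<open>K\<close>, where the products have bounded factors; off \<open>K\<close>
    the choice for \<open>h\<close> is arbitrary.\<close>
  define \<delta> where "\<delta> x = (SOME z. isGlb UNIV (box_dist n x ` S) z)" for x
  define h where "h x = (SOME z. isGlb UNIV ((\<lambda>y. m (F y) (box_dist n x y)) ` S) z)" for x
  define G where "G x = (if x \<in> S then F x else SOME z. m z (\<delta> x) = h x)" for x
  have \<delta>: "isGlb UNIV (box_dist n x ` S) (\<delta> x)" for x
    unfolding \<delta>_def using \<delta>_ex by (rule someI_ex)
  have h: "isGlb UNIV ((\<lambda>y. m (F y) (box_dist n x y)) ` S) (h x)" if "x \<in> K" for x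
    unfolding h_def using h_ex[OF that] by (rule someI_ex)
  have \<delta>_pos: "0 < \<delta> x" if x: "x \<in> K" "x \<notin> S" for x
  proof -
    have "x \<in> pow_set n" using x by (simp add: K_def)
    then obtain e where "0 < e" "\<And>y. y \<in> S \<Longrightarrow> e \<le> box_dist n x y"
      using closedin_pow_top_separated[OF e\<^sub>0 closed _ x(2)] by blast
    moreover from this have "e \<le> \<delta> x" using \<delta>[of x] by (simp add: isGlb_UNIV_iff)
    ultimately show ?thesis by simp
  qed
  interpret riesz_extension u m "box_dist n" S K F \<delta> h G p
  proof unfold_locales
    fix x y z :: "nat \<Rightarrow> 'a" and e :: 'a
    show "\<exists>r>0. \<forall>y\<in>S. box_dist n x y < r \<longrightarrow> F x - F y < e \<and> F y - F x < e"
      if x: "x \<in> S" and e: "0 < e"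
    proof -
      obtain r where "0 < r" "\<And>y. y \<in> S \<Longrightarrow> box_dist n x y < r \<Longrightarrow> f x - f y < e \<and> f y - f x < e"
        using continuous_map_pow_topD[OF cont S_pow x e] by blast
      then show ?thesis using x by (intro exI[of _ r]) (simp add: F_def)
    qed
    show "m (G x) (\<delta> x) = h x" if "x \<in> K" "x \<notin> S"
      using someI_ex[OF m_divide[of "\<delta> x" "h x"]] \<delta>_pos[OF that] that(2) by (simp add: G_def)
    show "box_dist n x y = box_dist n y x" by (rule box_dist_commute)
    show "box_dist n x z \<le> box_dist n x y + box_dist n y z" by (rule box_dist_triangle)
  qed (use False F_bounds \<delta> h \<delta>_pos in \<open>auto simp: G_def box_dist_nonneg \<open>0 < p\<close>\<close>)
  define g where "g x = G (clamp n a b x) - s" for x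
  have clamp_K: "clamp n a b x \<in> K" for x
    using \<open>a \<le> b\<close> by (auto simp: K_def clamp_def)
  have "clamp n a b x = x" if "x \<in> S" for x
  proof -
    have x: "x \<in> {..<n} \<rightarrow>\<^sub>E {a<..<b}" using box that by blast
    then have "max a (min b (x i)) = x i" if "i < n" for i
      using that by (auto simp: PiE_iff less_imp_le max_absorb2 min_absorb2)
    then have "clamp n a b x = restrict x {..<n}" by (auto simp: clamp_def)
    then show ?thesis using x by (simp add: PiE_restrict)
  qed
  then have g_S: "g x = f x" if "x \<in> S" for x
    using that by (simp add: g_def G_def F_def)
  have G_cont: "\<exists>r>0. \<forall>x'\<in>K. box_dist n x x' < r \<longrightarrow> G x - G x' < e \<and> G x' - G x < e"
    if "x \<in> K" "0 < e" for x e
    using G_continuous_at_S G_continuous_off_S that by (cases "x \<in> S") auto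
  have g_cont: "continuous_map (pow_top n) euclidean g"
  proof (rule continuous_map_pow_topI[OF e\<^sub>0])
    fix x :: "nat \<Rightarrow> 'a" and e :: 'a assume "0 < e"
    then obtain r where r: "0 < r" "\<And>x'. x' \<in> K \<Longrightarrow> box_dist n (clamp n a b x) x' < r \<Longrightarrow>
        G (clamp n a b x) - G x' < e \<and> G x' - G (clamp n a b x) < e"
      using G_cont[OF clamp_K] by blast
    have "g x - g y < e \<and> g y - g x < e" if "box_dist n x y < r" for y
      using r(2)[OF clamp_K le_less_trans[OF box_dist_clamp that]] by (simp add: g_def)
    then show "\<exists>d>0. \<forall>y\<in>pow_set n. box_dist n x y < d \<longrightarrow> g x - g y < e \<and> g y - g x < e"
      using r(1) by blast
  qed
  \<comment> \<open>A description of the graph of \<open>G\<close> in definable terms: the chosen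
    infima become quantified witnesses, and \<open>m\<close> becomes \<open>mb\<close>. The range
    condition on \<open>z\<close> makes \<open>mb z d\<close> the true product, and cancelling the
    positive \<open>\<delta> r\<close> then determines \<open>z\<close>.\<close>
  have G_iff: "z = G r \<longleftrightarrow> (\<exists>d. isGlb UNIV (box_dist n r ` S) d \<and>
      (\<exists>e. isGlb UNIV ((\<lambda>y. mb (F y) (box_dist n r y)) ` S) e \<and>
        - R < z \<and> z < R \<and> mb z d = e))" (is "_ \<longleftrightarrow> ?rhs") if r: "r \<in> K" "r \<notin> S" for z r
  proof -
    have im: "(\<lambda>y. mb (F y) (box_dist n r y)) ` S = (\<lambda>y. m (F y) (box_dist n r y)) ` S"
      using mb_eq[OF r(1)] by (intro image_cong) auto
    have unique: "isGlb UNIV A z \<Longrightarrow> isGlb UNIV A z' \<Longrightarrow> z = z'" for A and z z' :: 'a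
      by (simp add: isGlb_UNIV_iff antisym)
    have "isGlb UNIV (box_dist n r ` S) d \<longleftrightarrow> d = \<delta> r" for d
      using unique[OF \<delta>[OF r(1)], of d] \<delta>[OF r(1)] by auto
    moreover have "isGlb UNIV ((\<lambda>y. m (F y) (box_dist n r y)) ` S) e \<longleftrightarrow> e = h r" for e
      using unique[OF h[OF r(1)], of e] h[OF r(1)] by auto
    ultimately have "?rhs \<longleftrightarrow> - R < z \<and> z < R \<and> mb z (\<delta> r) = h r"
      unfolding im by simp
    also have "\<dots> \<longleftrightarrow> - R < z \<and> z < R \<and> m z (\<delta> r) = m (G r) (\<delta> r)"
    proof -
      obtain y where "y \<in> S" using False by blast
      then have "\<delta> r \<le> b - a" using \<delta>_le[OF r(1)] dist_le[OF r(1)] order_trans by blast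
      then have "- R < \<delta> r" "\<delta> r < R" using R' R'' \<delta>_pos[OF r] by auto
      then show ?thesis using G_mult[OF r] by (auto simp: mb_def)
    qed
    also have "\<dots> \<longleftrightarrow> z = G r"
    proof -
      have "- R < G r" "G r < R" using R R'' G_bounds[OF r(1)] \<open>0 < p\<close> by auto
      then show ?thesis using m_le_cancel \<delta>_pos[OF r] by (metis antisym order_refl)
    qed
    finally show ?thesis by blast
  qed
  \<comment> \<open>The clamped point enters as a quantified tuple \<open>r\<close>, determined
    uniquely by its coordinates. Adding \<open>s\<close> to the value undoes the shift, and the
    result has the shape handled by the closure rules for \<open>defpred\<close>.\<close>
  have g_iff: "v n = g (\<lambda>i\<in>{..<n}. v i) \<longleftrightarrow> (\<exists>r\<in>pow_set n. (\<forall>i<n. r i = max a (min b (v i))) \<and>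
      (r \<in> S \<longrightarrow> v n + s = F r) \<and>
      (r \<notin> S \<longrightarrow> (\<exists>d. isGlb UNIV (box_dist n r ` S) d \<and>
        (\<exists>e. isGlb UNIV ((\<lambda>y. mb (F y) (box_dist n r y)) ` S) e \<and>
          - R < v n + s \<and> v n + s < R \<and> mb (v n + s) d = e))))" for v
  proof -
    define r where "r = clamp n a b (\<lambda>i\<in>{..<n}. v i)"
    have r: "r' \<in> pow_set n \<and> (\<forall>i<n. r' i = max a (min b (v i))) \<longleftrightarrow> r' = r" for r'
      by (auto simp: r_def clamp_def fun_eq_iff PiE_iff extensional_def)
    have ex: "(\<exists>r'\<in>pow_set n. (\<forall>i<n. r' i = max a (min b (v i))) \<and> Q r' \<and> Q' r') \<longleftrightarrow> Q r \<and> Q' r"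
      for Q Q'
    proof -
      have "(\<exists>r'\<in>pow_set n. (\<forall>i<n. r' i = max a (min b (v i))) \<and> Q r' \<and> Q' r') \<longleftrightarrow>
          (\<exists>r'. (r' \<in> pow_set n \<and> (\<forall>i<n. r' i = max a (min b (v i)))) \<and> Q r' \<and> Q' r')"
        by blast
      also have "\<dots> \<longleftrightarrow> Q r \<and> Q' r" unfolding r by simp
      finally show ?thesis .
    qed
    have "r \<in> K" by (simp add: r_def clamp_K)
    have "v n = g (\<lambda>i\<in>{..<n}. v i) \<longleftrightarrow> v n + s = G r"
      by (auto simp: g_def r_def eq_diff_eq)
    moreover have "v n + s = G r \<longleftrightarrow> v n + s = F r" if "r \<in> S"
      using G_eq[OF that] by simp
    ultimately show ?thesis
      unfolding ex using G_iff[OF \<open>r \<in> K\<close>, of "v n + s"] by argo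
  qed
  have "defpred \<M> (\<lambda>v. (\<lambda>i\<in>{..<n}. v i) \<in> pow_set n \<and> v n = g (\<lambda>i\<in>{..<n}. v i))"
    unfolding g_iff
    by (intro defpred_conj defpred_ex_tuple defpred_all_less defpred_imp defpred_not defpred_ex
        defpred_isGlb[OF S] defpred_mem[OF S] defpred_eq defpred_less mb F dist
        deffun_plus deffun_max deffun_min deffun_var deffun_const)
      (simp_all add: deffun_var defpred_const)
  then have "definable_fun \<M> n (pow_set n) g"
    by (simp only: definable_fun_iff_defpred[OF order_refl])
  then show ?thesis using g_cont g_S by blast
qed

end
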